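(* Let $d\ge 3$ and let $\Omega\subset\mathbb{R}^d$ be a domain of finite measure. Then for every $\nu>0$ the number $N(\nu,-\Delta^{\mathcal{D}})$ of eigenvalues below $\nu$ of the Dirichlet Laplacian $-\Delta^{\mathcal{D}}$ in $L^2(\Omega)$ satisfies $$N(\nu,-\Delta^{\mathcal{D}})\le(2\pi)^{-d}\,\nu^{\frac{d}{2}}\,|\Omega|\,|\mathbb{S}^{d-1}|\,\frac{1}{d}\left(\frac{d}{d-2}\right)^{d/2} .$$
   Context: $|\Omega|$ is Lebesgue measure and $|\mathbb{S}^{d-1}|$ is the surface area of the unit sphere in $\mathbb{R}^d$. $-\Delta^{\mathcal{D}}$ is the operator of the Dirichlet boundary value problem $-\Delta u=\nu u$ in $\Omega$, $u|_{\partial\Omega}=0$, acting in $L^2(\Omega)$ (i.e. the self-adjoint operator associated with the form $\int_\Omega|\nabla u|^2\,dx$ on $H^1_0(\Omega)$). With $\{\nu_k\}$ its eigenvalues counted with multiplicity, $N(\nu,-\Delta^{\mathcal{D}})=\#\{k:\nu_k<\nu\}$. *)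

theory Defs
  imports "HOL-Analysis.Analysis"
begin

text \<open>
  Elements of \<open>L\<^sup>2(\<Omega>)\<close> are represented by square integrable functions; equality in
  \<open>L\<^sup>2(\<Omega>)\<close> is equality almost everywhere with respect to \<open>lebesgue_on \<Omega>\<close>,
  and the values of a representative outside \<open>\<Omega>\<close> are irrelevant.
\<close>

definition L2 :: "'a::euclidean_space set \<Rightarrow> ('a \<Rightarrow> complex) set" where
  "L2 \<Omega> = {u \<in> borel_measurable (lebesgue_on \<Omega>).
             integrable (lebesgue_on \<Omega>) (\<lambda>x. (cmod (u x))\<^sup>2)}"

definition L2_inner :: "'a::euclidean_space set \<Rightarrow> ('a \<Rightarrow> complex) \<Rightarrow> ('a \<Rightarrow> complex) \<Rightarrow> complex" where
  "L2_inner \<Omega> u v = (LINT x|lebesgue_on \<Omega>. u x * cnj (v x))"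

definition L2_norm :: "'a::euclidean_space set \<Rightarrow> ('a \<Rightarrow> complex) \<Rightarrow> real" where
  "L2_norm \<Omega> u = sqrt (LINT x|lebesgue_on \<Omega>. (cmod (u x))\<^sup>2)"

abbreviation partial_deriv :: "'a::euclidean_space \<Rightarrow> ('a \<Rightarrow> complex) \<Rightarrow> 'a \<Rightarrow> complex" where
  "partial_deriv b f \<equiv> (\<lambda>x. frechet_derivative f (at x) b)"

primrec C_k :: "nat \<Rightarrow> ('a::euclidean_space \<Rightarrow> complex) \<Rightarrow> bool" where
  "C_k 0 f \<longleftrightarrow> continuous_on UNIV f"
| "C_k (Suc k) f \<longleftrightarrow> (\<forall>x. f differentiable (at x)) \<and> (\<forall>b\<in>Basis. C_k k (partial_deriv b f))"

text \<open>
  \<open>C\<^sub>c\<^sup>\<infinity>(\<Omega>)\<close>; its elements are understood as extended by zero to the whole space.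
\<close>

definition test_functions :: "'a::euclidean_space set \<Rightarrow> ('a \<Rightarrow> complex) set" where
  "test_functions \<Omega> = {\<phi>. (\<forall>k. C_k k \<phi>) \<and> compact (closure {x. \<phi> x \<noteq> 0})
                        \<and> closure {x. \<phi> x \<noteq> 0} \<subseteq> \<Omega>}"

text \<open>
  \<open>u \<in> H\<^sup>1(\<Omega>)\<close> with weak gradient \<open>g\<close>, where \<open>g b\<close> is the partial derivative
  in the coordinate direction \<open>b \<in> Basis\<close>. The weak gradient is kept as an argument
  because it is determined by \<open>u\<close> only up to null sets.
\<close>

definition has_weak_gradient ::
  "'a::euclidean_space set \<Rightarrow> ('a \<Rightarrow> complex) \<Rightarrow> ('a \<Rightarrow> 'a \<Rightarrow> complex) \<Rightarrow> bool" where
  "has_weak_gradient \<Omega> u g \<longleftrightarrow>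
     u \<in> L2 \<Omega> \<and>
     (\<forall>b\<in>Basis. g b \<in> L2 \<Omega> \<and>
        (\<forall>\<phi>\<in>test_functions \<Omega>.
           (LINT x|lebesgue_on \<Omega>. u x * partial_deriv b \<phi> x)
             = - (LINT x|lebesgue_on \<Omega>. g b x * \<phi> x)))"

text \<open>\<open>H\<^sup>1\<^sub>0(\<Omega>)\<close>: the closure of \<open>C\<^sub>c\<^sup>\<infinity>(\<Omega>)\<close> in \<open>H\<^sup>1(\<Omega>)\<close>.\<close>

definition H10 :: "'a::euclidean_space set \<Rightarrow> ('a \<Rightarrow> complex) set" where
  "H10 \<Omega> = {u. \<exists>g. has_weak_gradient \<Omega> u g \<and>
     (\<exists>\<phi>. (\<forall>n::nat. \<phi> n \<in> test_functions \<Omega>) \<and>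
       (\<lambda>n. L2_norm \<Omega> (\<lambda>x. \<phi> n x - u x)) \<longlonglongrightarrow> 0 \<and>
       (\<forall>b\<in>Basis. (\<lambda>n. L2_norm \<Omega> (\<lambda>x. partial_deriv b (\<phi> n) x - g b x)) \<longlonglongrightarrow> 0))}"

text \<open>
  The graph of the operator associated with the form \<open>\<integral> \<nabla>u \<sqdot> \<nabla>v\<close> on \<open>H\<^sup>1\<^sub>0(\<Omega>)\<close>: \<open>u\<close> lies
  in its domain and is mapped to \<open>f\<close> if and only if \<open>u\<close> lies in the form domain and the form
  value at \<open>u, v\<close> is the inner product of \<open>f\<close> with \<open>v\<close>, for all \<open>v\<close> in the form domain.
\<close>

definition dirichlet_laplacian ::
  "'a::euclidean_space set \<Rightarrow> ('a \<Rightarrow> complex) \<Rightarrow> ('a \<Rightarrow> complex) \<Rightarrow> bool" where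
  "dirichlet_laplacian \<Omega> u f \<longleftrightarrow>
     u \<in> H10 \<Omega> \<and> f \<in> L2 \<Omega> \<and>
     (\<exists>g. has_weak_gradient \<Omega> u g \<and>
       (\<forall>v\<in>H10 \<Omega>. \<forall>h. has_weak_gradient \<Omega> v h \<longrightarrow>
          (\<Sum>b\<in>Basis. L2_inner \<Omega> (g b) (h b)) = L2_inner \<Omega> f v))"

definition eigenspace :: "'a::euclidean_space set \<Rightarrow> real \<Rightarrow> ('a \<Rightarrow> complex) set" where
  "eigenspace \<Omega> \<mu> = {u. dirichlet_laplacian \<Omega> u (\<lambda>x. of_real \<mu> * u x)}"

definition L2_independent :: "'a::euclidean_space set \<Rightarrow> nat \<Rightarrow> (nat \<Rightarrow> 'a \<Rightarrow> complex) \<Rightarrow> bool" where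
  "L2_independent \<Omega> k u \<longleftrightarrow>
     (\<forall>c :: nat \<Rightarrow> complex.
        (AE x in lebesgue_on \<Omega>. (\<Sum>i<k. c i * u i x) = 0) \<longrightarrow> (\<forall>i<k. c i = 0))"

text \<open>
  The complex dimension of the eigenspace as a subspace of \<open>L\<^sup>2(\<Omega>)\<close>. It is \<open>0\<close> exactly when
  \<open>\<mu>\<close> is not an eigenvalue. Only real \<open>\<mu>\<close> matter since the operator is self-adjoint.
\<close>

definition multiplicity_of :: "'a::euclidean_space set \<Rightarrow> real \<Rightarrow> enat" where
  "multiplicity_of \<Omega> \<mu> =
     (SUP k \<in> {k. \<exists>u. (\<forall>i<k. u i \<in> eigenspace \<Omega> \<mu>) \<and> L2_independent \<Omega> k u}. enat k)"

text \<open>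
  The number of eigenvalues below \<open>\<nu>\<close>, counted with multiplicity. The value \<open>\<infinity>\<close> is possible
  a priori, so an upper bound by a real number includes finiteness.
\<close>

definition eigenvalue_count :: "'a::euclidean_space set \<Rightarrow> real \<Rightarrow> ennreal" where
  "eigenvalue_count \<Omega> \<nu> = (\<Sum>\<^sub>\<infinity>\<mu>\<in>{..<\<nu>}. ennreal_of_enat (multiplicity_of \<Omega> \<mu>))"

text \<open>
  Surface measure on the unit sphere as it occurs in polar coordinates, i.e. the dimension times
  the Lebesgue measure of the cone over the set.
\<close>

definition sphere_measure :: "'a::euclidean_space set \<Rightarrow> real" where
  "sphere_measure A =
     real DIM('a) * measure lebesgue {r *\<^sub>R x | r x. 0 < r \<and> r \<le> 1 \<and> x \<in> A}"

lemma sphere_measure_sphere: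
  "sphere_measure (sphere (0::'a::euclidean_space) 1)
     = 2 * pi powr (real DIM('a) / 2) / Gamma (real DIM('a) / 2)"
proof -
  have eq: "{r *\<^sub>R x | r x. 0 < r \<and> r \<le> 1 \<and> x \<in> sphere (0::'a) 1} = cball 0 1 - {0}"
    (is "?L = ?R")
  proof
    show "?L \<subseteq> ?R" by auto
    show "?R \<subseteq> ?L"
    proof
      fix y assume "y \<in> ?R"
      then have "y = norm y *\<^sub>R (y /\<^sub>R norm y) \<and> 0 < norm y \<and> norm y \<le> 1
          \<and> y /\<^sub>R norm y \<in> sphere 0 1"
        by auto
      then show "y \<in> ?L" by blast
    qed
  qed
  have "measure lebesgue (cball (0::'a) 1 - {0}) = measure lebesgue (cball (0::'a) 1)"
    by (rule measure_Diff_null_set) auto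
  also have "\<dots> = unit_ball_vol (real DIM('a))"
    using content_cball[of 1 "0::'a"] by (simp add: measure_completion)
  finally have "sphere_measure (sphere (0::'a) 1) = real DIM('a) * unit_ball_vol (real DIM('a))"
    unfolding sphere_measure_def eq by simp
  also have "\<dots> = 2 * pi powr (real DIM('a) / 2) / Gamma (real DIM('a) / 2)"
  proof -
    have pos: "real DIM('a) / 2 > 0" by simp
    then have "real DIM('a) / 2 \<notin> \<int>\<^sub>\<le>\<^sub>0"
      by (meson leD nonpos_Ints_nonpos)
    then have "Gamma (real DIM('a) / 2 + 1) = real DIM('a) / 2 * Gamma (real DIM('a) / 2)"
      by (rule Gamma_plus1)
    then show ?thesis
      using Gamma_real_pos[OF pos] by (simp only: unit_ball_vol_def) (simp add: field_simps)
  qed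
  finally show ?thesis .
qed

end

theory Submission
  imports Defs "HOL-Probability.Characteristic_Functions"
begin

text \<open>
  The bound is the one of Berezin, Li and Yau. Let \<open>u\<^sub>1, \<dots>, u\<^sub>N\<close> be orthonormal eigenfunctions
  with eigenvalues \<open>\<mu>\<^sub>1, \<dots>, \<mu>\<^sub>N\<close> below \<open>\<nu>\<close>, extended by zero, and let
  \<open>F \<xi> = (\<Sum>i\<le>N. (cmod (fourier u\<^sub>i \<xi>))\<^sup>2)\<close>. Three facts about \<open>F\<close> decide everything.
  Since \<open>fourier u\<^sub>i \<xi>\<close> is the inner product in \<open>L\<^sup>2(\<Omega>)\<close> of \<open>u\<^sub>i\<close> with the plane wave of frequency
  \<open>\<xi>\<close>, whose squared norm is \<open>|\<Omega>|\<close>, Bessel's inequality gives \<open>F \<le> |\<Omega>|\<close>. The Plancherel identity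
  gives \<open>\<integral>F = (2\<pi>)\<^sup>d N\<close>. Applied to the gradients, it gives
  \<open>\<integral>|\<xi>|\<^sup>2 F(\<xi>) d\<xi> = (2\<pi>)\<^sup>d (\<mu>\<^sub>1 + \<dots> + \<mu>\<^sub>N) \<le> (2\<pi>)\<^sup>d N \<nu>\<close>. Hence for every \<open>s \<ge> 0\<close>
  \<open>(2\<pi>)\<^sup>d N (s - \<nu>) \<le> \<integral>(s - |\<xi>|\<^sup>2) F(\<xi>) d\<xi> \<le> |\<Omega>| \<integral>max 0 (s - |\<xi>|\<^sup>2) d\<xi>\<close>.
  The last integral is the volume \<open>\<omega> s\<^bsup>d/2+1\<^esup> / (d/2+1)\<close> under a paraboloid, where \<open>\<omega>\<close> is the volume of
  the unit ball, and the choice \<open>s = \<nu> (d+2)/d\<close> yields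
  \<open>(2\<pi>)\<^sup>d N \<le> |\<Omega>| \<omega> (\<nu> (d+2)/d)\<^bsup>d/2\<^esup>\<close>. This is at least as strong as the claim because
  \<open>(d+2)/d \<le> d/(d-2)\<close>, and \<open>\<omega>\<close> is \<open>1/d\<close> times the area of the unit sphere.

  Only test functions are ever transformed. The Plancherel identity, for bounded continuous integrable
  functions, follows by testing the transform of the autocorrelation against dilated Gaussians
  (\<open>plancherel\<close>), and \<open>berezin_li_yau_test_functions\<close> is the integrated inequality
  above, with any upper bound on \<open>F\<close> in place of \<open>|\<Omega>|\<close>.
  Eigenfunctions enter as limits: each is approximated in \<open>L\<^sup>2(\<Omega>)\<close> by test functions whose Dirichlet
  energies tend to the eigenvalue (\<open>eigenfunction_approximation\<close>), and the bound on \<open>F\<close> holds for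
  the approximations up to an error that is uniform in \<open>\<xi>\<close> (\<open>li_yau_orthonormal\<close>). Gram-Schmidt
  inside the eigenspaces and the orthogonality of different eigenspaces supply the orthonormal system.
\<close>

section \<open>The Fourier transform and the Gaussian\<close>

lemma borel_measurable_cis [measurable]:
  "f \<in> borel_measurable M \<Longrightarrow> (\<lambda>x. cis (f x)) \<in> borel_measurable M"
  by (rule measurable_compose[where g=cis and N=borel])
     (simp_all add: borel_measurable_continuous_onI continuous_on_cis)

lemma borel_measurable_cnj [measurable]:
  "f \<in> borel_measurable M \<Longrightarrow> (\<lambda>x. cnj (f x)) \<in> borel_measurable M"
  by (rule measurable_compose[where N=borel])
     (simp_all add: borel_measurable_continuous_onI continuous_on_cnj)

lemma norm_square_Basis: "(norm x)\<^sup>2 = (\<Sum>b\<in>Basis. (x \<bullet> b)\<^sup>2)"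
  by (simp add: norm_eq_sqrt_inner euclidean_inner[of x x] power2_eq_square sum_nonneg)

definition fourier :: "('a::euclidean_space \<Rightarrow> complex) \<Rightarrow> 'a \<Rightarrow> complex" where
  "fourier f \<xi> = (LINT x|lborel. f x * cis (- (\<xi> \<bullet> x)))"

lemma integrable_mult_cis:
  assumes "integrable M f" and "g \<in> borel_measurable M"
  shows "integrable M (\<lambda>x. f x * cis (g x))"
  by (rule Bochner_Integration.integrable_bound[OF assms(1)])
     (use assms in \<open>auto simp: norm_mult\<close>)

lemma norm_fourier_le:
  "cmod (fourier f \<xi>) \<le> (LINT x|lborel. cmod (f x))"
  unfolding fourier_def by (rule order_trans[OF integral_norm_bound]) (simp add: norm_mult)

lemma borel_measurable_fourier [measurable]:
  assumes [measurable]: "f \<in> borel_measurable borel"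
  shows "fourier f \<in> borel_measurable borel"
proof -
  have "(\<lambda>\<xi>. LINT x|lborel. f x * cis (- (\<xi> \<bullet> x))) \<in> borel_measurable borel"
    by (rule lborel.borel_measurable_lebesgue_integral) measurable
  then show ?thesis by (simp add: fourier_def[abs_def])
qed

text \<open>
  Both sides are the double integral of \<open>f x * g \<xi> * cis (- (\<xi> \<bullet> x))\<close>, whose kernel is symmetric in
  \<open>\<xi>\<close> and \<open>x\<close>.
\<close>

lemma fourier_multiplication_formula:
  fixes f g :: "'a::euclidean_space \<Rightarrow> complex"
  assumes f: "integrable lborel f" and g: "integrable lborel g"
  shows "(LINT \<xi>|lborel. fourier f \<xi> * g \<xi>) = (LINT x|lborel. f x * fourier g x)"
proof -
  have [measurable]: "f \<in> borel_measurable borel" "g \<in> borel_measurable borel"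
    using f g by (auto dest: borel_measurable_integrable)
  have "integrable (lborel \<Otimes>\<^sub>M lborel) (\<lambda>(x, \<xi>). f x * g \<xi> * cis (- (\<xi> \<bullet> x)))"
  proof (rule lborel_pair.Fubini_integrable)
    show "(\<lambda>(x, \<xi>). f x * g \<xi> * cis (- (\<xi> \<bullet> x))) \<in> borel_measurable (lborel \<Otimes>\<^sub>M lborel)"
      by measurable
    show "integrable lborel (\<lambda>x. LINT \<xi>|lborel. norm (case (x, \<xi>) of (x, \<xi>) \<Rightarrow> f x * g \<xi> * cis (- (\<xi> \<bullet> x))))"
      using f by (simp add: norm_mult)
    show "AE x in lborel. integrable lborel (\<lambda>\<xi>. case (x, \<xi>) of (x, \<xi>) \<Rightarrow> f x * g \<xi> * cis (- (\<xi> \<bullet> x)))"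
      using g by (auto intro!: integrable_mult_cis)
  qed
  note fub = lborel_pair.Fubini_integral[OF this]
  have "(LINT \<xi>|lborel. fourier f \<xi> * g \<xi>)
      = (LINT \<xi>|lborel. LINT x|lborel. f x * g \<xi> * cis (- (\<xi> \<bullet> x)))"
    unfolding fourier_def
    by (subst Bochner_Integration.integral_mult_left[symmetric])
       (auto intro!: integrable_mult_cis f simp: mult_ac)
  also have "\<dots> = (LINT x|lborel. LINT \<xi>|lborel. f x * g \<xi> * cis (- (\<xi> \<bullet> x)))"
    by (rule fub)
  also have "\<dots> = (LINT x|lborel. f x * fourier g x)"
    unfolding fourier_def by (simp add: mult.assoc inner_commute)
  finally show ?thesis .
qed

lemma lborel_integral_affine:
  fixes f :: "'a::euclidean_space \<Rightarrow> 'b::{banach, second_countable_topology}"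
  assumes "c \<noteq> 0" and [measurable]: "f \<in> borel_measurable borel"
  shows "(LINT x|lborel. f x) = \<bar>c\<bar> ^ DIM('a) *\<^sub>R (LINT x|lborel. f (t + c *\<^sub>R x))"
  by (subst lborel_affine[OF assms(1), of t])
     (simp add: integral_density integral_distr)

lemma lborel_integrable_affine:
  fixes f :: "'a::euclidean_space \<Rightarrow> 'b::{banach, second_countable_topology}"
  assumes "c \<noteq> 0" and f: "integrable lborel f"
  shows "integrable lborel (\<lambda>x. f (t + c *\<^sub>R x))"
proof -
  have [measurable]: "f \<in> borel_measurable borel" using f by auto
  have "integrable (density (distr lborel borel (\<lambda>x. t + c *\<^sub>R x)) (\<lambda>_. ennreal (\<bar>c\<bar> ^ DIM('a)))) f"
    using f by (subst (asm) lborel_affine[OF assms(1), of t]) (simp add: ennreal_power)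
  then have "integrable lborel (\<lambda>x. \<bar>c\<bar> ^ DIM('a) *\<^sub>R f (t + c *\<^sub>R x))"
    by (simp add: integrable_density integrable_distr_eq)
  from integrable_scaleR_right[OF this, of "inverse (\<bar>c\<bar> ^ DIM('a))"] show ?thesis
    using assms(1) by simp
qed

lemma lborel_product_integral:
  fixes f :: "'a::euclidean_space \<Rightarrow> real \<Rightarrow> complex"
  assumes f: "\<And>b. b \<in> Basis \<Longrightarrow> integrable lborel (f b)"
  shows "integrable lborel (\<lambda>x. \<Prod>b\<in>Basis. f b (x \<bullet> b))"
    and "(LINT x|lborel. (\<Prod>b\<in>Basis. f b (x \<bullet> b))) = (\<Prod>b\<in>Basis. (LINT t|lborel. f b t))"
proof -
  interpret product_sigma_finite "\<lambda>_::'a. lborel::real measure" ..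
  have [measurable]: "\<And>b. b \<in> Basis \<Longrightarrow> f b \<in> borel_measurable borel"
    using f by (auto dest: borel_measurable_integrable)
  have coord: "(\<Prod>b\<in>Basis. f b ((\<Sum>c\<in>Basis. x c *\<^sub>R c) \<bullet> b)) = (\<Prod>b\<in>Basis. f b (x b))" for x
    by (intro prod.cong) auto
  show "integrable lborel (\<lambda>x. \<Prod>b\<in>Basis. f b (x \<bullet> b))"
    unfolding lborel_eq[where 'a='a]
    by (subst integrable_distr_eq) (auto simp: coord intro!: product_integrable_prod f)
  show "(LINT x|lborel. (\<Prod>b\<in>Basis. f b (x \<bullet> b))) = (\<Prod>b\<in>Basis. (LINT t|lborel. f b t))"
    unfolding lborel_eq[where 'a='a]
    by (subst integral_distr) (auto simp: coord intro!: product_integral_prod f)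
qed

definition gaussian :: "'a::euclidean_space \<Rightarrow> real" where
  "gaussian x = exp (- (norm x)\<^sup>2 / 2)"

lemma borel_measurable_gaussian [measurable]: "gaussian \<in> borel_measurable borel"
  unfolding gaussian_def[abs_def] by measurable

lemma real_gaussian_eq: "exp (- t\<^sup>2 / 2) = sqrt (2 * pi) * std_normal_density t"
  by (simp add: std_normal_density_def)

lemma real_gaussian_fourier:
  "integrable lborel (\<lambda>t::real. complex_of_real (exp (- t\<^sup>2 / 2)) * cis (- (s * t)))"
  "(LINT t|lborel. complex_of_real (exp (- t\<^sup>2 / 2)) * cis (- (s * t)))
     = complex_of_real (sqrt (2 * pi) * exp (- s\<^sup>2 / 2))"
proof -
  have int: "integrable lborel (\<lambda>t::real. exp (- t\<^sup>2 / 2))"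
    unfolding real_gaussian_eq by (intro integrable_mult_right integrable_normal_density) auto
  show "integrable lborel (\<lambda>t::real. complex_of_real (exp (- t\<^sup>2 / 2)) * cis (- (s * t)))"
    by (intro integrable_mult_cis integrable_of_real int) auto
  have "complex_of_real (exp (- s\<^sup>2 / 2)) = char std_normal_distribution (- s)"
    by (simp add: char_std_normal_distribution)
  also have "\<dots> = (LINT t|lborel. std_normal_density t *\<^sub>R cis (- (s * t)))"
    unfolding char_def by (subst integral_density) (auto simp: cis_conv_exp normal_density_nonneg)
  finally show "(LINT t|lborel. complex_of_real (exp (- t\<^sup>2 / 2)) * cis (- (s * t)))
     = complex_of_real (sqrt (2 * pi) * exp (- s\<^sup>2 / 2))"
    unfolding real_gaussian_eq by (simp add: scaleR_conv_of_real mult.assoc)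
qed

text \<open>
  The Gaussian and the character both factor over the coordinates, so its transform reduces to the
  characteristic function of the standard normal distribution on the line.
\<close>

lemma gaussian_cis_prod:
  fixes \<xi> x :: "'a::euclidean_space"
  shows "complex_of_real (gaussian x) * cis (- (\<xi> \<bullet> x)) =
    (\<Prod>b\<in>Basis. complex_of_real (exp (- (x \<bullet> b)\<^sup>2 / 2)) * cis (- ((\<xi> \<bullet> b) * (x \<bullet> b))))"
proof -
  have 1: "gaussian x = (\<Prod>b\<in>Basis. exp (- (x \<bullet> b)\<^sup>2 / 2))"
    by (simp add: gaussian_def norm_square_Basis exp_sum[symmetric] sum_negf sum_divide_distrib)
  have 2: "cis (- (\<xi> \<bullet> x)) = (\<Prod>b\<in>Basis. cis (- ((\<xi> \<bullet> b) * (x \<bullet> b))))"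
    by (simp add: cis_conv_exp exp_sum[symmetric] euclidean_inner[of \<xi> x] sum_negf sum_distrib_left)
  show ?thesis
    by (simp add: 1 2 prod.distrib)
qed

lemma fourier_gaussian:
  "fourier (\<lambda>x. complex_of_real (gaussian x)) (\<xi>::'a::euclidean_space)
     = complex_of_real (sqrt (2 * pi) ^ DIM('a) * gaussian \<xi>)"
proof -
  have 1: "gaussian \<xi> = (\<Prod>b\<in>Basis. exp (- (\<xi> \<bullet> b)\<^sup>2 / 2))"
    by (simp add: gaussian_def norm_square_Basis exp_sum[symmetric] sum_negf sum_divide_distrib)
  show ?thesis
    unfolding fourier_def gaussian_cis_prod
    by (subst lborel_product_integral(2)[OF real_gaussian_fourier(1)])
       (simp add: real_gaussian_fourier(2)[simplified] 1 prod.distrib)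
qed

lemma integrable_gaussian: "integrable lborel (gaussian :: 'a::euclidean_space \<Rightarrow> real)"
proof -
  have "integrable lborel (\<lambda>x::'a. complex_of_real (gaussian x) * cis (- (0 \<bullet> x)))"
    unfolding gaussian_cis_prod by (intro lborel_product_integral(1) real_gaussian_fourier(1))
  then have "integrable lborel (\<lambda>x::'a. complex_of_real (gaussian x))" by simp
  then show ?thesis by (simp only: complex_of_real_integrable_eq)
qed

lemma integral_gaussian:
  "(LINT x|lborel. gaussian (x::'a::euclidean_space)) = sqrt (2 * pi) ^ DIM('a)"
proof -
  have "complex_of_real (LINT x|lborel. gaussian (x::'a)) = fourier (\<lambda>x. complex_of_real (gaussian x)) (0::'a)"
    by (simp add: fourier_def)
  also have "\<dots> = complex_of_real (sqrt (2 * pi) ^ DIM('a))"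
    by (subst fourier_gaussian) (simp add: gaussian_def)
  finally show ?thesis by (simp only: of_real_eq_iff)
qed

section \<open>Plancherel identity\<close>

lemma fourier_scaled_gaussian:
  fixes x :: "'a::euclidean_space"
  assumes "\<epsilon> > 0"
  shows "fourier (\<lambda>\<xi>. complex_of_real (gaussian (\<epsilon> *\<^sub>R \<xi>))) x
    = complex_of_real (inverse \<epsilon> ^ DIM('a) * sqrt (2 * pi) ^ DIM('a) * gaussian (inverse \<epsilon> *\<^sub>R x))"
proof -
  have "fourier (\<lambda>\<xi>. complex_of_real (gaussian (\<epsilon> *\<^sub>R \<xi>))) x
      = inverse \<epsilon> ^ DIM('a) *\<^sub>R fourier (\<lambda>\<xi>. complex_of_real (gaussian \<xi>)) (inverse \<epsilon> *\<^sub>R x)"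
    unfolding fourier_def
    by (subst lborel_integral_affine[where c="inverse \<epsilon>" and t=0]) (use assms in auto)
  then show ?thesis
    by (simp add: fourier_gaussian scaleR_conv_of_real)
qed

text \<open>
  Testing a transform against a Gaussian of width \<open>1/\<epsilon>\<close> is testing the function itself against a
  Gaussian of width \<open>\<epsilon>\<close>. As \<open>\<epsilon>\<close> tends to \<open>0\<close>, this turns the integral of the transform into the
  value of the function at the origin.
\<close>

lemma gaussian_mean_fourier:
  fixes A :: "'a::euclidean_space \<Rightarrow> complex"
  assumes A: "integrable lborel A" and "\<epsilon> > 0"
  shows "(LINT \<xi>|lborel. fourier A \<xi> * complex_of_real (gaussian (\<epsilon> *\<^sub>R \<xi>)))
    = complex_of_real (sqrt (2 * pi) ^ DIM('a)) *
      (LINT x|lborel. A (\<epsilon> *\<^sub>R x) * complex_of_real (gaussian x))"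
proof -
  have [measurable]: "A \<in> borel_measurable borel" using A by auto
  have "integrable lborel (\<lambda>\<xi>::'a. gaussian (0 + \<epsilon> *\<^sub>R \<xi>))"
    using assms by (intro lborel_integrable_affine integrable_gaussian) auto
  then have "integrable lborel (\<lambda>\<xi>::'a. complex_of_real (gaussian (\<epsilon> *\<^sub>R \<xi>)))"
    by simp
  then have "(LINT \<xi>|lborel. fourier A \<xi> * complex_of_real (gaussian (\<epsilon> *\<^sub>R \<xi>)))
      = (LINT x|lborel. A x * complex_of_real (inverse \<epsilon> ^ DIM('a) * sqrt (2 * pi) ^ DIM('a)
            * gaussian (inverse \<epsilon> *\<^sub>R x)))"
    by (simp only: fourier_multiplication_formula[OF A] fourier_scaled_gaussian[OF \<open>\<epsilon> > 0\<close>])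
  also have "\<dots> = \<epsilon> ^ DIM('a) *\<^sub>R (LINT x|lborel. A (\<epsilon> *\<^sub>R x) * complex_of_real
        (inverse \<epsilon> ^ DIM('a) * sqrt (2 * pi) ^ DIM('a) * gaussian x))"
    by (subst lborel_integral_affine[where c=\<epsilon> and t=0]) (use assms in auto)
  also have "\<dots> = \<epsilon> ^ DIM('a) *\<^sub>R (LINT x|lborel. complex_of_real (inverse \<epsilon> ^ DIM('a)
      * sqrt (2 * pi) ^ DIM('a)) * (A (\<epsilon> *\<^sub>R x) * complex_of_real (gaussian x)))"
    by (simp add: mult_ac)
  also have "\<dots> = (complex_of_real \<epsilon> * inverse (complex_of_real \<epsilon>)) ^ DIM('a) *
      (complex_of_real (sqrt (2 * pi) ^ DIM('a)) *
      (LINT x|lborel. A (\<epsilon> *\<^sub>R x) * complex_of_real (gaussian x)))"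
    unfolding integral_mult_right_zero power_mult_distrib of_real_mult
    by (simp add: scaleR_conv_of_real)
  also have "\<dots> = complex_of_real (sqrt (2 * pi) ^ DIM('a)) *
      (LINT x|lborel. A (\<epsilon> *\<^sub>R x) * complex_of_real (gaussian x))"
    using assms by simp
  finally show ?thesis .
qed

text \<open>
  The limit \<open>\<epsilon> \<rightarrow> 0\<close> in \<open>gaussian_mean_fourier\<close>. The Gaussian weights increase to \<open>1\<close>, so for a nonnegative transform
  the left-hand side converges monotonically; the right-hand side converges by domination.
\<close>

lemma fourier_inversion_at_0:
  fixes A :: "'a::euclidean_space \<Rightarrow> complex"
  assumes A: "integrable lborel A" and bd: "\<And>x. cmod (A x) \<le> B" and cont: "isCont A 0"
    and p: "\<And>\<xi>. fourier A \<xi> = complex_of_real (p \<xi>)" and p0: "\<And>\<xi>. 0 \<le> p \<xi>"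
  shows "(\<integral>\<^sup>+\<xi>. ennreal (p \<xi>) \<partial>lborel) = ennreal ((2 * pi) ^ DIM('a) * Re (A 0))"
proof -
  define \<epsilon> :: "nat \<Rightarrow> real" where "\<epsilon> n = inverse (real (Suc n))" for n
  have \<epsilon>: "\<epsilon> n > 0" for n by (simp add: \<epsilon>_def)
  have \<epsilon>0: "\<epsilon> \<longlonglongrightarrow> 0" unfolding \<epsilon>_def[abs_def] by (rule LIMSEQ_inverse_real_of_nat)
  have [measurable]: "A \<in> borel_measurable borel" using A by auto
  have p_eq: "p = (\<lambda>\<xi>. Re (fourier A \<xi>))" by (simp add: p)
  have [measurable]: "p \<in> borel_measurable borel" unfolding p_eq by measurable
  have p_le: "p \<xi> \<le> (LINT x|lborel. cmod (A x))" for \<xi>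
    using norm_fourier_le[of A \<xi>] p0[of \<xi>] by (simp add: p)
  have int: "integrable lborel (\<lambda>\<xi>. p \<xi> * gaussian (\<epsilon> n *\<^sub>R \<xi>))" for n
  proof (rule Bochner_Integration.integrable_bound)
    show "integrable lborel (\<lambda>\<xi>::'a. (LINT x|lborel. cmod (A x)) * gaussian (0 + \<epsilon> n *\<^sub>R \<xi>))"
      using \<epsilon>[of n] by (intro integrable_mult_right lborel_integrable_affine integrable_gaussian) auto
    show "AE \<xi> in lborel. norm (p \<xi> * gaussian (\<epsilon> n *\<^sub>R \<xi>))
        \<le> norm ((LINT x|lborel. cmod (A x)) * gaussian (0 + \<epsilon> n *\<^sub>R \<xi>))"
      using p0 order_trans[OF p_le abs_ge_self]
      by (intro AE_I2) (simp add: gaussian_def abs_mult mult_right_mono)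
  qed measurable
  define K where "K = sqrt (2 * pi) ^ DIM('a)"
  have lim: "(\<lambda>n. LINT x|lborel. A (\<epsilon> n *\<^sub>R x) * complex_of_real (gaussian x))
      \<longlonglongrightarrow> (LINT x::'a|lborel. A 0 * complex_of_real (gaussian x))"
  proof (rule integral_dominated_convergence[where w="\<lambda>x. B * gaussian x"])
    show "AE x in lborel. (\<lambda>n. A (\<epsilon> n *\<^sub>R x) * complex_of_real (gaussian x))
        \<longlonglongrightarrow> A 0 * complex_of_real (gaussian x)"
    proof (intro AE_I2 tendsto_intros)
      fix x :: 'a
      have "(\<lambda>n. \<epsilon> n *\<^sub>R x) \<longlonglongrightarrow> 0 *\<^sub>R x" by (intro tendsto_intros \<epsilon>0)
      then show "(\<lambda>n. A (\<epsilon> n *\<^sub>R x)) \<longlonglongrightarrow> A 0"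
        using isCont_tendsto_compose[OF cont] by simp
    qed
    show "AE x in lborel. norm (A (\<epsilon> n *\<^sub>R x) * complex_of_real (gaussian x)) \<le> B * gaussian x" for n
      using bd by (auto simp: norm_mult gaussian_def intro!: mult_right_mono)
  qed (auto intro!: integrable_mult_right integrable_gaussian)
  have ceq: "complex_of_real (LINT \<xi>|lborel. p \<xi> * gaussian (\<epsilon> n *\<^sub>R \<xi>))
      = K * (LINT x|lborel. A (\<epsilon> n *\<^sub>R x) * complex_of_real (gaussian x))" for n
    using gaussian_mean_fourier[OF A \<epsilon>[of n]]
    unfolding p K_def[symmetric] of_real_mult[symmetric] integral_complex_of_real .
  have eq: "(LINT \<xi>|lborel. p \<xi> * gaussian (\<epsilon> n *\<^sub>R \<xi>))
      = Re (K * (LINT x|lborel. A (\<epsilon> n *\<^sub>R x) * complex_of_real (gaussian x)))" for n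
    unfolding ceq[symmetric] Re_complex_of_real ..
  have "(\<lambda>n. LINT \<xi>|lborel. p \<xi> * gaussian (\<epsilon> n *\<^sub>R \<xi>))
      \<longlonglongrightarrow> Re (K * (LINT x::'a|lborel. A 0 * complex_of_real (gaussian x)))"
    unfolding eq by (intro tendsto_intros lim)
  also have "Re (K * (LINT x::'a|lborel. A 0 * complex_of_real (gaussian x))) = (K * K) * Re (A 0)"
  proof -
    have cI: "(LINT x::'a|lborel. A 0 * complex_of_real (gaussian x)) = A 0 * complex_of_real K"
      unfolding integral_mult_right_zero integral_complex_of_real integral_gaussian K_def ..
    show ?thesis
      unfolding cI times_complex.sel Re_complex_of_real Im_complex_of_real by simp
  qed
  also have "K * K = (2 * pi) ^ DIM('a)"
    unfolding K_def power_mult_distrib[symmetric] real_sqrt_mult_self by simp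
  finally have lim1: "(\<lambda>n. ennreal (LINT \<xi>|lborel. p \<xi> * gaussian (\<epsilon> n *\<^sub>R \<xi>)))
      \<longlonglongrightarrow> ennreal ((2 * pi) ^ DIM('a) * Re (A 0))"
    by (rule tendsto_ennrealI)
  have nn: "(\<integral>\<^sup>+\<xi>. ennreal (p \<xi> * gaussian (\<epsilon> n *\<^sub>R \<xi>)) \<partial>lborel)
      = ennreal (LINT \<xi>|lborel. p \<xi> * gaussian (\<epsilon> n *\<^sub>R \<xi>))" for n
    by (rule nn_integral_eq_integral[OF int]) (auto simp: p0 gaussian_def)
  have "(\<lambda>n. \<integral>\<^sup>+\<xi>. ennreal (p \<xi> * gaussian (\<epsilon> n *\<^sub>R \<xi>)) \<partial>lborel)
      \<longlonglongrightarrow> (\<integral>\<^sup>+\<xi>. ennreal (p \<xi>) \<partial>lborel)"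
  proof (rule nn_integral_LIMSEQ)
    show "incseq (\<lambda>n \<xi>. ennreal (p \<xi> * gaussian (\<epsilon> n *\<^sub>R \<xi>)))"
    proof (intro incseq_SucI le_funI ennreal_leI mult_left_mono p0)
      fix n and \<xi> :: 'a
      have "\<epsilon> (Suc n) \<le> \<epsilon> n" by (simp add: \<epsilon>_def field_simps)
      then have "\<epsilon> (Suc n) * norm \<xi> \<le> \<epsilon> n * norm \<xi>" by (intro mult_right_mono) auto
      then have "(\<epsilon> (Suc n) * norm \<xi>)\<^sup>2 \<le> (\<epsilon> n * norm \<xi>)\<^sup>2"
        using \<epsilon>[of "Suc n"] by (intro power_mono) auto
      then show "gaussian (\<epsilon> n *\<^sub>R \<xi>) \<le> gaussian (\<epsilon> (Suc n) *\<^sub>R \<xi>)"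
        using \<epsilon>[of "Suc n"] \<epsilon>[of n] by (simp add: gaussian_def power_mult_distrib)
    qed
    fix \<xi> :: 'a
    have "(\<lambda>n. p \<xi> * exp (- (norm (\<epsilon> n *\<^sub>R \<xi>))\<^sup>2 / 2)) \<longlonglongrightarrow> p \<xi> * exp (- (norm (0 *\<^sub>R \<xi>))\<^sup>2 / 2)"
      by (intro tendsto_intros \<epsilon>0) simp
    then show "(\<lambda>n. ennreal (p \<xi> * gaussian (\<epsilon> n *\<^sub>R \<xi>))) \<longlonglongrightarrow> ennreal (p \<xi>)"
      by (intro tendsto_ennrealI) (simp add: gaussian_def)
  qed measurable
  with lim1 show ?thesis
    unfolding nn by (rule LIMSEQ_unique[symmetric])
qed

text \<open>
  Inversion at the origin for the autocorrelation \<open>h \<mapsto> \<integral> f (x + h) * cnj (f x) dx\<close>: its transform is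
  \<open>(cmod (fourier f \<xi>))\<^sup>2\<close> and its value at the origin is the squared norm of \<open>f\<close>.
\<close>

lemma plancherel:
  fixes f :: "'a::euclidean_space \<Rightarrow> complex"
  assumes f: "integrable lborel f" and bd: "\<And>x. cmod (f x) \<le> B" and cont: "continuous_on UNIV f"
  shows "(\<integral>\<^sup>+\<xi>. ennreal ((cmod (fourier f \<xi>))\<^sup>2) \<partial>lborel)
    = ennreal ((2 * pi) ^ DIM('a) * (LINT x|lborel. (cmod (f x))\<^sup>2))"
proof -
  have [measurable]: "f \<in> borel_measurable borel" using f by auto
  have shift: "integrable lborel (\<lambda>h. f (x + h))" for x
    using lborel_integrable_affine[OF _ f, of 1 x] by simp
  have shift_int: "(LINT h|lborel. g (x + h)) = (LINT h|lborel. g h)"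
    if [measurable]: "g \<in> borel_measurable borel" for x and g :: "'a \<Rightarrow> complex"
    by (subst (2) lborel_integral_affine[of 1 _ x]) auto
  have shift_int_real: "(LINT h|lborel. g (x + h)) = (LINT h|lborel. g h)"
    if [measurable]: "g \<in> borel_measurable borel" for x and g :: "'a \<Rightarrow> real"
    by (subst (2) lborel_integral_affine[of 1 _ x]) auto
  define A where "A h = (LINT x|lborel. f (x + h) * cnj (f x))" for h
  \<comment> \<open>justifies both the integrability of \<open>A\<close> and the exchange of integrals in its transform\<close>
  have int2: "integrable (lborel \<Otimes>\<^sub>M lborel) (\<lambda>(x, h). f (x + h) * cnj (f x) * cis (- (\<xi> \<bullet> h)))" for \<xi>
  proof (rule lborel_pair.Fubini_integrable)
    show "integrable lborel (\<lambda>x. LINT h|lborel. norm (case (x, h) of (x, h) \<Rightarrow> f (x + h) * cnj (f x) * cis (- (\<xi> \<bullet> h))))"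
      using f by (simp add: norm_mult shift_int_real[of "\<lambda>x. norm (f x)"])
    show "AE x in lborel. integrable lborel (\<lambda>h. case (x, h) of (x, h) \<Rightarrow> f (x + h) * cnj (f x) * cis (- (\<xi> \<bullet> h)))"
      by (auto intro!: integrable_mult_cis integrable_mult_left shift)
  qed measurable
  have A_int: "integrable lborel A"
    unfolding A_def[abs_def]
    using lborel_pair.integrable_snd[OF int2[of 0]] by simp
  have A_fourier: "fourier A \<xi> = complex_of_real ((cmod (fourier f \<xi>))\<^sup>2)" for \<xi>
  proof -
    have "fourier A \<xi> = (LINT h|lborel. LINT x|lborel. f (x + h) * cnj (f x) * cis (- (\<xi> \<bullet> h)))"
      by (simp add: fourier_def A_def)
    also have "\<dots> = (LINT x|lborel. LINT h|lborel. f (x + h) * cnj (f x) * cis (- (\<xi> \<bullet> h)))"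
      by (rule lborel_pair.Fubini_integral[OF int2])
    also have "\<dots> = (LINT x|lborel. LINT h|lborel.
        cnj (f x * cis (- (\<xi> \<bullet> x))) * (f (x + h) * cis (- (\<xi> \<bullet> (x + h)))))"
    proof -
      have "cis (- (\<xi> \<bullet> h)) = cis (\<xi> \<bullet> x) * cis (- (\<xi> \<bullet> (x + h)))" for x h
        by (simp add: cis_mult inner_add_right)
      then show ?thesis by (simp add: cis_cnj mult_ac)
    qed
    also have "\<dots> = (LINT x|lborel. cnj (f x * cis (- (\<xi> \<bullet> x))) *
        (LINT h|lborel. f (x + h) * cis (- (\<xi> \<bullet> (x + h)))))"
      by (simp only: integral_mult_right_zero)
    also have "\<dots> = (LINT x|lborel. cnj (f x * cis (- (\<xi> \<bullet> x))) * fourier f \<xi>)"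
      by (subst shift_int[of "\<lambda>h. f h * cis (- (\<xi> \<bullet> h))"]) (simp_all add: fourier_def)
    also have "\<dots> = cnj (fourier f \<xi>) * fourier f \<xi>"
      unfolding fourier_def integral_mult_left_zero Bochner_Integration.integral_cnj ..
    also have "\<dots> = complex_of_real ((cmod (fourier f \<xi>))\<^sup>2)"
      by (metis complex_norm_square mult.commute)
    finally show ?thesis .
  qed
  have A_bd: "cmod (A h) \<le> B * (LINT x|lborel. cmod (f x))" for h
  proof -
    have "cmod (A h) \<le> (LINT x|lborel. B * cmod (f x))"
      unfolding A_def
    proof (rule Bochner_Integration.integral_norm_bound_integral)
      have le: "cmod (f (x + h) * cnj (f x)) \<le> B * cmod (f x)" for x
        using bd by (simp add: norm_mult mult_right_mono)
      then show "norm (f (x + h) * cnj (f x)) \<le> B * cmod (f x)" for x .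
      show "integrable lborel (\<lambda>x. f (x + h) * cnj (f x))"
        by (rule Bochner_Integration.integrable_bound[where f="\<lambda>x. B * cmod (f x)"])
          (use f le in \<open>auto intro: order_trans[OF _ abs_ge_self]\<close>)
    qed (use f in auto)
    then show ?thesis by simp
  qed
  have A_cont: "isCont A 0"
    unfolding continuous_at_sequentially
  proof (intro allI impI)
    fix h :: "nat \<Rightarrow> 'a" assume h: "h \<longlonglongrightarrow> 0"
    show "(A \<circ> h) \<longlonglongrightarrow> A 0"
      unfolding comp_def A_def
    proof (rule integral_dominated_convergence[where w="\<lambda>x. B * cmod (f x)"])
      show "AE x in lborel. (\<lambda>n. f (x + h n) * cnj (f x)) \<longlonglongrightarrow> f (x + 0) * cnj (f x)"
      proof (intro AE_I2 tendsto_intros)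
        fix x
        have "isCont f (x + 0)" using cont by (simp add: continuous_on_eq_continuous_at)
        then show "(\<lambda>n. f (x + h n)) \<longlonglongrightarrow> f (x + 0)"
          by (rule isCont_tendsto_compose) (intro tendsto_intros h)
      qed
      show "AE x in lborel. norm (f (x + h n) * cnj (f x)) \<le> B * cmod (f x)" for n
        using bd by (auto simp: norm_mult intro!: mult_right_mono)
    qed (use f in auto)
  qed
  have A0: "A 0 = complex_of_real (LINT x|lborel. (cmod (f x))\<^sup>2)"
    unfolding A_def add_0_right complex_norm_square[symmetric] integral_complex_of_real ..
  show ?thesis
    using fourier_inversion_at_0[OF A_int A_bd A_cont A_fourier zero_le_power2]
    unfolding A0 Re_complex_of_real .
qed

section \<open>Test functions\<close>

lemma test_functionD:
  assumes "\<phi> \<in> test_functions \<Omega>"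
  shows "C_k k \<phi>" "compact (closure {x. \<phi> x \<noteq> 0})" "closure {x. \<phi> x \<noteq> 0} \<subseteq> \<Omega>"
  using assms by (auto simp: test_functions_def)

lemma test_function_differentiable:
  "\<phi> \<in> test_functions \<Omega> \<Longrightarrow> \<phi> differentiable (at x)"
  using test_functionD(1)[of \<phi> \<Omega> "Suc 0"] by simp

lemma test_function_continuous: "\<phi> \<in> test_functions \<Omega> \<Longrightarrow> continuous_on A \<phi>"
  using test_functionD(1)[of \<phi> \<Omega> 0] by (auto intro: continuous_on_subset)

lemma test_function_eq_0: "\<phi> \<in> test_functions \<Omega> \<Longrightarrow> x \<notin> \<Omega> \<Longrightarrow> \<phi> x = 0"
  using test_functionD(3)[of \<phi> \<Omega>] closure_subset[of "{x. \<phi> x \<noteq> 0}"] by auto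

lemma test_function_measurable: "\<phi> \<in> test_functions \<Omega> \<Longrightarrow> \<phi> \<in> borel_measurable borel"
  using test_function_continuous[of \<phi> \<Omega> UNIV] by (rule borel_measurable_continuous_onI)

lemma in_support: "f x \<noteq> 0 \<Longrightarrow> x \<in> closure {x. f x \<noteq> 0}"
  by (rule subsetD[OF closure_subset]) simp

lemma frechet_derivative_outside_support:
  assumes "x \<notin> closure {x. f x \<noteq> 0}"
  shows "frechet_derivative f (at x) = (\<lambda>_. 0)"
proof -
  have "(f has_derivative (\<lambda>_. 0)) (at x)"
  proof (rule has_derivative_transform_within_open)
    show "((\<lambda>_. 0) has_derivative (\<lambda>_. 0)) (at x)" by simp
    show "open (- closure {x. f x \<noteq> 0})" by (intro open_Compl closed_closure)
    show "x \<in> - closure {x. f x \<noteq> 0}" using assms by simp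
    show "\<And>y. y \<in> - closure {x. f x \<noteq> 0} \<Longrightarrow> 0 = f y"
      using in_support[of f] by auto
  qed
  then show ?thesis by (rule frechet_derivative_at[symmetric])
qed

lemma compact_closure_subset: "compact S \<Longrightarrow> closure T \<subseteq> S \<Longrightarrow> compact (closure T)"
  using compact_Int_closed[of S "closure T"] by (simp add: Int_absorb1)

lemma test_function_partial_deriv:
  assumes "\<phi> \<in> test_functions \<Omega>" and "b \<in> Basis"
  shows "partial_deriv b \<phi> \<in> test_functions \<Omega>"
proof -
  have "C_k k (partial_deriv b \<phi>)" for k
    using test_functionD(1)[OF assms(1), of "Suc k"] assms(2) by simp
  moreover have "{x. partial_deriv b \<phi> x \<noteq> 0} \<subseteq> closure {x. \<phi> x \<noteq> 0}"
    using frechet_derivative_outside_support[of _ \<phi>] by force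
  then have sub: "closure {x. partial_deriv b \<phi> x \<noteq> 0} \<subseteq> closure {x. \<phi> x \<noteq> 0}"
    by (rule closure_minimal) simp
  moreover have "compact (closure {x. partial_deriv b \<phi> x \<noteq> 0})"
    by (rule compact_closure_subset[OF test_functionD(2)[OF assms(1)] sub])
  ultimately show ?thesis
    using test_functionD(3)[OF assms(1)] by (simp add: test_functions_def subset_trans)
qed

lemma has_derivative_cnj_frechet:
  assumes "f differentiable (at x)"
  shows "((\<lambda>x. cnj (f x)) has_derivative (\<lambda>h. cnj (frechet_derivative f (at x) h))) (at x)"
  using assms by (intro bounded_linear.has_derivative[OF bounded_linear_cnj])
     (simp add: frechet_derivative_works[symmetric])

lemma C_k_cnj: "C_k k f \<Longrightarrow> C_k k (\<lambda>x. cnj (f x))"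
proof (induction k arbitrary: f)
  case 0
  then show ?case by (auto intro: continuous_intros)
next
  case (Suc k)
  have d: "f differentiable (at x)" for x using Suc.prems by simp
  have "partial_deriv b (\<lambda>x. cnj (f x)) = (\<lambda>x. cnj (partial_deriv b f x))" for b
    by (rule ext) (simp add: frechet_derivative_at[OF has_derivative_cnj_frechet[OF d], symmetric])
  then show ?case
    using Suc has_derivative_cnj_frechet[OF d] by (auto simp: differentiable_def)
qed

lemma test_function_cnj:
  "\<phi> \<in> test_functions \<Omega> \<Longrightarrow> (\<lambda>x. cnj (\<phi> x)) \<in> test_functions \<Omega>"
  by (auto simp: test_functions_def C_k_cnj)

lemma C_k_linear: "C_k k f \<Longrightarrow> C_k k g \<Longrightarrow> C_k k (\<lambda>x. c * f x + g x)"
proof (induction k arbitrary: f g)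
  case 0
  then show ?case by (auto intro!: continuous_intros)
next
  case (Suc k)
  have d: "((\<lambda>x. c * f x + g x) has_derivative
      (\<lambda>h. c * frechet_derivative f (at x) h + frechet_derivative g (at x) h)) (at x)" for x
    using Suc.prems by (auto intro!: derivative_intros simp: frechet_derivative_works[symmetric])
  have "partial_deriv b (\<lambda>x. c * f x + g x) = (\<lambda>x. c * partial_deriv b f x + partial_deriv b g x)" for b
    by (rule ext) (simp add: frechet_derivative_at[OF d, symmetric])
  then show ?case
    using Suc differentiableI[OF d] by simp
qed

lemma partial_deriv_linear:
  assumes "f differentiable (at x)" "g differentiable (at x)"
  shows "partial_deriv b (\<lambda>x. c * f x + g x) x = c * partial_deriv b f x + partial_deriv b g x"
proof -
  have "((\<lambda>x. c * f x + g x) has_derivative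
      (\<lambda>h. c * frechet_derivative f (at x) h + frechet_derivative g (at x) h)) (at x)"
    using assms by (auto intro!: derivative_intros simp: frechet_derivative_works[symmetric])
  then show ?thesis by (simp add: frechet_derivative_at[symmetric])
qed

lemma test_function_linear:
  assumes "\<phi> \<in> test_functions \<Omega>" "\<psi> \<in> test_functions \<Omega>"
  shows "(\<lambda>x. c * \<phi> x + \<psi> x) \<in> test_functions \<Omega>"
proof -
  have "{x. c * \<phi> x + \<psi> x \<noteq> 0} \<subseteq> closure {x. \<phi> x \<noteq> 0} \<union> closure {x. \<psi> x \<noteq> 0}"
  proof
    fix x assume "x \<in> {x. c * \<phi> x + \<psi> x \<noteq> 0}"
    then have "\<phi> x \<noteq> 0 \<or> \<psi> x \<noteq> 0" by auto
    then show "x \<in> closure {x. \<phi> x \<noteq> 0} \<union> closure {x. \<psi> x \<noteq> 0}"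
      by (blast intro: in_support)
  qed
  then have sub: "closure {x. c * \<phi> x + \<psi> x \<noteq> 0} \<subseteq> closure {x. \<phi> x \<noteq> 0} \<union> closure {x. \<psi> x \<noteq> 0}"
    by (rule closure_minimal) auto
  have "compact (closure {x. \<phi> x \<noteq> 0} \<union> closure {x. \<psi> x \<noteq> 0})"
    using assms by (intro compact_Un test_functionD(2))
  then have "compact (closure {x. c * \<phi> x + \<psi> x \<noteq> 0})"
    by (rule compact_closure_subset[OF _ sub])
  moreover have "closure {x. c * \<phi> x + \<psi> x \<noteq> 0} \<subseteq> \<Omega>"
    using sub test_functionD(3)[OF assms(1)] test_functionD(3)[OF assms(2)] by blast
  ultimately show ?thesis
    using assms by (auto simp: test_functions_def intro: C_k_linear)
qed

lemma test_function_bounded: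
  assumes "\<phi> \<in> test_functions \<Omega>"
  obtains B where "\<And>x. cmod (\<phi> x) \<le> B" "B \<ge> 0"
proof -
  have "compact (\<phi> ` closure {x. \<phi> x \<noteq> 0})"
    using assms by (intro compact_continuous_image test_function_continuous test_functionD(2))
  then obtain B where B: "B > 0" "\<And>x. x \<in> closure {x. \<phi> x \<noteq> 0} \<Longrightarrow> cmod (\<phi> x) \<le> B"
    using compact_imp_bounded bounded_pos by (metis imageI)
  have "cmod (\<phi> x) \<le> B" for x
    using B in_support[of \<phi> x] by (cases "\<phi> x = 0") auto
  then show ?thesis by (rule that) (use B(1) in auto)
qed

lemma test_function_integrable:
  assumes "\<phi> \<in> test_functions \<Omega>"
  shows "integrable lborel \<phi>"
proof -
  have "integrable lborel (\<lambda>x. indicator (closure {x. \<phi> x \<noteq> 0}) x *\<^sub>R \<phi> x)"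
    using assms by (intro borel_integrable_compact test_function_continuous test_functionD(2))
  also have "(\<lambda>x. indicator (closure {x. \<phi> x \<noteq> 0}) x *\<^sub>R \<phi> x) = \<phi>"
    using closure_subset[of "{x. \<phi> x \<noteq> 0}"] by (auto simp: indicator_def fun_eq_iff)
  finally show ?thesis .
qed

section \<open>Test functions on the Fourier side\<close>

lemma plancherel_test_function:
  fixes \<phi> :: "'a::euclidean_space \<Rightarrow> complex"
  assumes "\<phi> \<in> test_functions \<Omega>"
  shows "(\<integral>\<^sup>+\<xi>. ennreal ((cmod (fourier \<phi> \<xi>))\<^sup>2) \<partial>lborel)
    = ennreal ((2 * pi) ^ DIM('a) * (LINT x|lborel. (cmod (\<phi> x))\<^sup>2))"
  by (rule test_function_bounded[OF assms])
     (rule plancherel[OF test_function_integrable[OF assms] _ test_function_continuous[OF assms]])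

lemma has_vector_derivative_along:
  assumes "\<phi> differentiable (at (x + t *\<^sub>R b))"
  shows "((\<lambda>t. \<phi> (x + t *\<^sub>R b)) has_vector_derivative partial_deriv b \<phi> (x + t *\<^sub>R b)) (at t)"
proof -
  have 1: "(\<phi> has_derivative frechet_derivative \<phi> (at (x + t *\<^sub>R b))) (at (x + t *\<^sub>R b))"
    using assms by (simp add: frechet_derivative_works[symmetric])
  have "((\<lambda>t. x + t *\<^sub>R b) has_derivative (\<lambda>s. s *\<^sub>R b)) (at t)"
    by (auto intro!: derivative_eq_intros)
  from has_derivative_compose[OF this 1] show ?thesis
    using has_derivative_linear[OF 1] by (simp add: has_vector_derivative_def linear_cmul)
qed

lemma has_vector_derivative_quotient:
  assumes "(f has_vector_derivative D) (at (0::real))"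
  shows "((\<lambda>s. (f s - f 0) /\<^sub>R s) \<longlongrightarrow> D) (at 0)"
proof -
  have "((\<lambda>s. norm (f s - f 0 - s *\<^sub>R D) / norm s) \<longlongrightarrow> 0) (at 0)"
    using assms by (simp add: has_vector_derivative_def has_derivative_at)
  then have "((\<lambda>s. norm ((f s - f 0) /\<^sub>R s - D)) \<longlongrightarrow> 0) (at 0)"
  proof (rule Lim_transform_eventually)
    have "norm (f s - f 0 - s *\<^sub>R D) / norm s = norm ((f s - f 0) /\<^sub>R s - D)" if "s \<noteq> 0" for s
    proof -
      have "(f s - f 0) /\<^sub>R s - D = (f s - f 0 - s *\<^sub>R D) /\<^sub>R s"
        using that by (simp add: scaleR_diff_right)
      then show ?thesis by (simp add: divide_inverse mult.commute)
    qed
    then show "\<forall>\<^sub>F s in at 0. norm (f s - f 0 - s *\<^sub>R D) / norm s = norm ((f s - f 0) /\<^sub>R s - D)"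
      by (auto simp: eventually_at intro!: exI[of _ 1])
  qed
  then show ?thesis
    using tendsto_norm_zero_iff LIM_zero_iff by blast
qed

text \<open>
  Translation by \<open>t *\<^sub>R b\<close> multiplies the transform by \<open>cis (t * (\<xi> \<bullet> b))\<close>. Dividing the difference by \<open>t\<close> and
  letting \<open>t\<close> tend to \<open>0\<close> gives the claim; the difference quotients are dominated since they are
  bounded by the supremum of the derivative and live on one fixed ball.
\<close>

lemma fourier_partial_deriv:
  fixes \<phi> :: "'a::euclidean_space \<Rightarrow> complex"
  assumes \<phi>: "\<phi> \<in> test_functions \<Omega>" and b: "b \<in> Basis"
  shows "fourier (partial_deriv b \<phi>) \<xi> = \<i> * complex_of_real (\<xi> \<bullet> b) * fourier \<phi> \<xi>"
proof -
  define t :: "nat \<Rightarrow> real" where "t n = inverse (real (Suc n))" for n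
  have t: "t n > 0" "t n \<le> 1" for n by (auto simp: t_def field_simps)
  have t0: "filterlim t (at 0) sequentially"
    unfolding t_def[abs_def] filterlim_at using LIMSEQ_inverse_real_of_nat by auto
  have [measurable]: "\<phi> \<in> borel_measurable borel" "partial_deriv b \<phi> \<in> borel_measurable borel"
    using \<phi> b by (auto intro: test_function_measurable test_function_partial_deriv)
  define q where "q n x = (\<phi> (x + t n *\<^sub>R b) - \<phi> x) /\<^sub>R t n" for n x
  have [measurable]: "q n \<in> borel_measurable borel" for n
    unfolding q_def[abs_def] by measurable
  obtain B where B: "\<And>x. cmod (partial_deriv b \<phi> x) \<le> B" "B \<ge> 0"
    by (rule test_function_bounded[OF test_function_partial_deriv[OF \<phi> b]]) blast
  obtain R where R: "R > 0" "\<And>x. \<phi> x \<noteq> 0 \<Longrightarrow> norm x \<le> R"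
    using compact_imp_bounded[OF test_functionD(2)[OF \<phi>]] closure_subset[of "{x. \<phi> x \<noteq> 0}"]
    unfolding bounded_pos by blast
  have q_le: "cmod (q n x) \<le> B" for n x
  proof -
    have "\<exists>s\<in>{0<..<t n}. norm (\<phi> (x + t n *\<^sub>R b) - \<phi> (x + 0 *\<^sub>R b))
        \<le> norm ((t n - 0) *\<^sub>R partial_deriv b \<phi> (x + s *\<^sub>R b))"
    proof (rule mvt_general[OF t(1)])
      show "continuous_on {0..t n} (\<lambda>s. \<phi> (x + s *\<^sub>R b))"
        by (rule continuous_on_compose2[OF test_function_continuous[OF \<phi>, of UNIV]])
           (auto intro!: continuous_intros)
      show "((\<lambda>s. \<phi> (x + s *\<^sub>R b)) has_derivative (\<lambda>h. h *\<^sub>R partial_deriv b \<phi> (x + s *\<^sub>R b))) (at s)" for s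
        using has_vector_derivative_along[OF test_function_differentiable[OF \<phi>]]
        by (simp add: has_vector_derivative_def)
    qed
    then obtain s where "norm (\<phi> (x + t n *\<^sub>R b) - \<phi> x)
        \<le> t n * norm (partial_deriv b \<phi> (x + s *\<^sub>R b))"
      using t(1)[of n] by auto
    also have "\<dots> \<le> t n * B" using B(1) t(1)[of n] by (intro mult_left_mono) auto
    finally have "norm (\<phi> (x + t n *\<^sub>R b) - \<phi> x) / t n \<le> B"
      using t(1)[of n] by (simp add: pos_divide_le_eq mult.commute)
    then show ?thesis
      using t(1)[of n] unfolding q_def norm_scaleR by (simp add: divide_inverse mult.commute)
  qed
  have q_0: "q n x = 0" if "norm x > R + 1" for n x
  proof -
    have "norm (x + t n *\<^sub>R b) \<ge> norm x - norm (t n *\<^sub>R b)"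
      using norm_triangle_ineq4[of "x + t n *\<^sub>R b" "t n *\<^sub>R b"] by simp
    moreover have "norm (t n *\<^sub>R b) \<le> 1" using t[of n] b by simp
    ultimately have "norm (x + t n *\<^sub>R b) > R" "norm x > R" using that by auto
    then have "\<phi> (x + t n *\<^sub>R b) = 0" "\<phi> x = 0"
      using R(2) leD by blast+
    then show ?thesis by (simp add: q_def)
  qed
  have lim: "(\<lambda>n. LINT x|lborel. q n x * cis (- (\<xi> \<bullet> x))) \<longlonglongrightarrow> fourier (partial_deriv b \<phi>) \<xi>"
    unfolding fourier_def
  proof (rule integral_dominated_convergence[where w="\<lambda>x. indicator (cball 0 (R + 1)) x *\<^sub>R B"])
    show "integrable lborel (\<lambda>x::'a. indicator (cball 0 (R + 1)) x *\<^sub>R B)"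
      by (rule borel_integrable_compact) auto
    show "AE x in lborel. (\<lambda>n. q n x * cis (- (\<xi> \<bullet> x))) \<longlonglongrightarrow> partial_deriv b \<phi> x * cis (- (\<xi> \<bullet> x))"
    proof (intro AE_I2 tendsto_intros)
      fix x
      have "((\<lambda>s. \<phi> (x + s *\<^sub>R b)) has_vector_derivative partial_deriv b \<phi> (x + 0 *\<^sub>R b)) (at 0)"
        by (rule has_vector_derivative_along[OF test_function_differentiable[OF \<phi>]])
      from has_vector_derivative_quotient[OF this]
      have "((\<lambda>s. (\<phi> (x + s *\<^sub>R b) - \<phi> x) /\<^sub>R s) \<longlongrightarrow> partial_deriv b \<phi> x) (at 0)"
        by simp
      from filterlim_compose[OF this t0] show "(\<lambda>n. q n x) \<longlonglongrightarrow> partial_deriv b \<phi> x"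
        by (simp add: q_def)
    qed
    show "AE x in lborel. norm (q n x * cis (- (\<xi> \<bullet> x))) \<le> indicator (cball 0 (R + 1)) x *\<^sub>R B" for n
    proof (rule AE_I2)
      fix x
      show "norm (q n x * cis (- (\<xi> \<bullet> x))) \<le> indicator (cball 0 (R + 1)) x *\<^sub>R B"
        using q_le[of n x] q_0[of x n] by (cases "norm x \<le> R + 1") (auto simp: norm_mult)
    qed
  qed measurable
  have int: "integrable lborel (\<lambda>x. \<phi> x * cis (- (\<xi> \<bullet> x)))"
    by (intro integrable_mult_cis test_function_integrable[OF \<phi>]) measurable
  have q_fourier: "(LINT x|lborel. q n x * cis (- (\<xi> \<bullet> x))) = (cis (t n * (\<xi> \<bullet> b)) - 1) /\<^sub>R t n * fourier \<phi> \<xi>" for n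
  proof -
    have int': "integrable lborel (\<lambda>x. \<phi> (x + t n *\<^sub>R b) * cis (- (\<xi> \<bullet> x)))"
      using lborel_integrable_affine[OF _ test_function_integrable[OF \<phi>], of 1 "t n *\<^sub>R b"]
      by (intro integrable_mult_cis) (simp_all add: add.commute)
    have "fourier \<phi> \<xi> = (LINT x|lborel. \<phi> (x + t n *\<^sub>R b) * cis (- (\<xi> \<bullet> (x + t n *\<^sub>R b))))"
      unfolding fourier_def
      by (subst lborel_integral_affine[of 1 _ "t n *\<^sub>R b"]) (simp_all add: add.commute)
    also have "\<dots> = (LINT x|lborel. \<phi> (x + t n *\<^sub>R b) * cis (- (\<xi> \<bullet> x)) * cis (- (t n * (\<xi> \<bullet> b))))"
      by (simp add: inner_add_right cis_mult mult.assoc)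
    also have "\<dots> = (LINT x|lborel. \<phi> (x + t n *\<^sub>R b) * cis (- (\<xi> \<bullet> x))) * cis (- (t n * (\<xi> \<bullet> b)))"
      by (rule integral_mult_left_zero)
    finally have "fourier \<phi> \<xi> * cis (t n * (\<xi> \<bullet> b)) = (LINT x|lborel. \<phi> (x + t n *\<^sub>R b) * cis (- (\<xi> \<bullet> x)))"
      by (simp add: mult.assoc cis_mult)
    moreover have "(LINT x|lborel. q n x * cis (- (\<xi> \<bullet> x)))
      = ((LINT x|lborel. \<phi> (x + t n *\<^sub>R b) * cis (- (\<xi> \<bullet> x))) - fourier \<phi> \<xi>) /\<^sub>R t n"
      unfolding fourier_def Bochner_Integration.integral_diff[OF int' int, symmetric]
      by (simp add: q_def left_diff_distrib)
    ultimately show ?thesis by (simp add: scaleR_conv_of_real algebra_simps)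
  qed
  have "(\<lambda>n. (cis (t n * (\<xi> \<bullet> b)) - 1) /\<^sub>R t n * fourier \<phi> \<xi>)
      \<longlonglongrightarrow> \<i> * complex_of_real (\<xi> \<bullet> b) * fourier \<phi> \<xi>"
  proof (intro tendsto_mult tendsto_const)
    have "((\<lambda>z. exp (\<i> * complex_of_real (\<xi> \<bullet> b) * z)) has_field_derivative
        \<i> * complex_of_real (\<xi> \<bullet> b)) (at (complex_of_real 0))"
      by (auto intro!: derivative_eq_intros)
    from has_vector_derivative_quotient[OF has_vector_derivative_real_field[OF this]]
    have "((\<lambda>s. (cis (s * (\<xi> \<bullet> b)) - 1) /\<^sub>R s) \<longlongrightarrow> \<i> * complex_of_real (\<xi> \<bullet> b)) (at 0)"
      by (simp add: cis_conv_exp mult_ac)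
    from filterlim_compose[OF this t0] show "(\<lambda>n. (cis (t n * (\<xi> \<bullet> b)) - 1) /\<^sub>R t n) \<longlonglongrightarrow> \<i> * complex_of_real (\<xi> \<bullet> b)" .
  qed
  with lim show ?thesis unfolding q_fourier by (rule LIMSEQ_unique)
qed

section \<open>Berezin inequality for test functions\<close>

text \<open>
  The region under the paraboloid, cut horizontally: the slice at height \<open>s - r\<close> is the ball of radius \<open>sqrt r\<close>.
\<close>

lemma nn_integral_paraboloid:
  assumes "s \<ge> 0"
  shows "(\<integral>\<^sup>+\<xi>. ennreal (max 0 (s - (norm (\<xi>::'a::euclidean_space))\<^sup>2)) \<partial>lborel)
    = ennreal (unit_ball_vol (real DIM('a)) * s powr (real DIM('a) / 2 + 1) / (real DIM('a) / 2 + 1))"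
proof -
  let ?d = "real DIM('a)"
  define \<omega> where "\<omega> = unit_ball_vol ?d"
  have \<omega>: "\<omega> \<ge> 0" by (simp add: \<omega>_def)
  \<comment> \<open>the height \<open>s - (norm \<xi>)\<^sup>2\<close> as the length of \<open>{(norm \<xi>)\<^sup>2..s}\<close>\<close>
  have layer: "ennreal (max 0 (s - (norm \<xi>)\<^sup>2))
      = (\<integral>\<^sup>+r. indicator {0..s} r * indicator {(\<xi>, r). (norm \<xi>)\<^sup>2 \<le> r} (\<xi>, r) \<partial>lborel)" for \<xi> :: 'a
  proof -
    have "(\<integral>\<^sup>+r. indicator {0..s} r * indicator {(\<xi>, r). (norm \<xi>)\<^sup>2 \<le> r} (\<xi>, r) \<partial>lborel)
        = (\<integral>\<^sup>+r. indicator {(norm \<xi>)\<^sup>2..s} r \<partial>lborel)"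
      by (intro nn_integral_cong)
         (auto simp: indicator_def intro: order_trans[OF zero_le_power2[of "norm \<xi>"]])
    also have "\<dots> = ennreal (max 0 (s - (norm \<xi>)\<^sup>2))"
      by (simp add: emeasure_lborel_Icc_eq max_def)
    finally show ?thesis ..
  qed
  have ball: "(\<integral>\<^sup>+\<xi>. indicator {(\<xi>::'a, r). (norm \<xi>)\<^sup>2 \<le> r} (\<xi>, r) \<partial>lborel)
      = ennreal (\<omega> * r powr (?d / 2))" if "r \<ge> 0" for r
  proof -
    have "(\<integral>\<^sup>+\<xi>. indicator {(\<xi>::'a, r). (norm \<xi>)\<^sup>2 \<le> r} (\<xi>, r) \<partial>lborel)
        = (\<integral>\<^sup>+\<xi>. indicator (cball (0::'a) (sqrt r)) \<xi> \<partial>lborel)"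
      using that by (intro nn_integral_cong) (auto simp: indicator_def real_le_rsqrt sqrt_ge_absD
        dest: real_le_rsqrt power_mono[of "norm _" "sqrt r" 2])
    also have "\<dots> = ennreal (\<omega> * sqrt r ^ DIM('a))"
      using that by (simp add: emeasure_cball \<omega>_def)
    also have "sqrt r ^ DIM('a) = r powr (?d / 2)"
      using that by (cases "r = 0") (auto simp: powr_half_sqrt[symmetric] powr_powr simp flip: powr_realpow)
    finally show ?thesis .
  qed
  have "(\<integral>\<^sup>+\<xi>. ennreal (max 0 (s - (norm (\<xi>::'a))\<^sup>2)) \<partial>lborel)
      = (\<integral>\<^sup>+r. \<integral>\<^sup>+\<xi>. indicator {0..s} r * indicator {(\<xi>::'a, r). (norm \<xi>)\<^sup>2 \<le> r} (\<xi>, r) \<partial>lborel \<partial>lborel)"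
    unfolding layer by (rule lborel_pair.Fubini'[symmetric]) measurable
  also have "\<dots> = (\<integral>\<^sup>+r. ennreal (indicator {0..s} r * (\<omega> * r powr (?d / 2))) \<partial>lborel)"
  proof (intro nn_integral_cong)
    fix r :: real
    have "(\<integral>\<^sup>+\<xi>. indicator {0..s} r * indicator {(\<xi>::'a, r). (norm \<xi>)\<^sup>2 \<le> r} (\<xi>, r) \<partial>lborel)
        = indicator {0..s} r * (\<integral>\<^sup>+\<xi>. indicator {(\<xi>::'a, r). (norm \<xi>)\<^sup>2 \<le> r} (\<xi>, r) \<partial>lborel)"
      by (rule nn_integral_cmult) measurable
    then show "(\<integral>\<^sup>+\<xi>. indicator {0..s} r * indicator {(\<xi>::'a, r). (norm \<xi>)\<^sup>2 \<le> r} (\<xi>, r) \<partial>lborel)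
        = ennreal (indicator {0..s} r * (\<omega> * r powr (?d / 2)))"
      using ball[of r] by (cases "r \<in> {0..s}") auto
  qed
  also have "\<dots> = ennreal (\<omega> * (s powr (?d / 2 + 1) / (?d / 2 + 1)))"
  proof (rule nn_integral_has_integral_lebesgue)
    have "- 1 < ?d / 2" by (rule order_less_le_trans[of _ 0]) auto
    then show "((\<lambda>r. \<omega> * r powr (?d / 2)) has_integral \<omega> * (s powr (?d / 2 + 1) / (?d / 2 + 1))) {0..s}"
      using assms by (intro has_integral_mult_right has_integral_powr_from_0)
  qed (use \<omega> in auto)
  finally show ?thesis by (simp add: \<omega>_def)
qed

text \<open>
  Pointwise, \<open>s * F \<le> max 0 (s - (norm \<xi>)\<^sup>2) * C + (norm \<xi>)\<^sup>2 * F\<close> whenever \<open>0 \<le> F \<le> C\<close>. Integrated over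
  \<open>\<xi>\<close>, the Plancherel identity turns the two terms with \<open>F\<close> into the norms of the functions and of
  their gradients. The constant \<open>C\<close> stands for Bessel's inequality, which test functions approximating an orthonormal
  system satisfy only approximately.
\<close>

lemma berezin_li_yau_test_functions:
  fixes \<phi> :: "'i \<Rightarrow> 'a::euclidean_space \<Rightarrow> complex"
  assumes "finite I" and \<phi>: "\<And>i. i \<in> I \<Longrightarrow> \<phi> i \<in> test_functions \<Omega>"
    and C: "\<And>\<xi>. (\<Sum>i\<in>I. (cmod (fourier (\<phi> i) \<xi>))\<^sup>2) \<le> C" and "s \<ge> 0"
  shows "(2 * pi) ^ DIM('a) * (s * (\<Sum>i\<in>I. LINT x|lborel. (cmod (\<phi> i x))\<^sup>2))
    \<le> C * (unit_ball_vol (real DIM('a)) * s powr (real DIM('a) / 2 + 1) / (real DIM('a) / 2 + 1))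
      + (2 * pi) ^ DIM('a) * (\<Sum>i\<in>I. \<Sum>b\<in>Basis. LINT x|lborel. (cmod (partial_deriv b (\<phi> i) x))\<^sup>2)"
proof -
  define K where "K = (2 * pi) ^ DIM('a)"
  have K: "K \<ge> 0" by (simp add: K_def)
  define V where "V = unit_ball_vol (real DIM('a)) * s powr (real DIM('a) / 2 + 1) / (real DIM('a) / 2 + 1)"
  have V: "V \<ge> 0" by (simp add: V_def)
  have C0: "C \<ge> 0" by (rule order_trans[OF sum_nonneg C[of 0]]) simp
  have meas: "\<phi> i \<in> borel_measurable borel" if "i \<in> I" for i
    using \<phi>[OF that] by (rule test_function_measurable)
  have [measurable]: "(\<lambda>\<xi>. fourier (\<phi> i) \<xi>) \<in> borel_measurable borel"
      "(\<lambda>\<xi>. fourier (partial_deriv b (\<phi> i)) \<xi>) \<in> borel_measurable borel" if "i \<in> I" "b \<in> Basis" for i b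
    using \<phi>[OF that(1)] that by (auto intro!: borel_measurable_fourier test_function_measurable[OF test_function_partial_deriv] meas)
  have [measurable]: "(\<lambda>\<xi>. fourier (\<phi> i) \<xi>) \<in> borel_measurable borel" if "i \<in> I" for i
    using meas[OF that] by (rule borel_measurable_fourier)
  have pointwise: "(\<Sum>i\<in>I. s * (cmod (fourier (\<phi> i) \<xi>))\<^sup>2)
      \<le> C * max 0 (s - (norm \<xi>)\<^sup>2) + (\<Sum>i\<in>I. \<Sum>b\<in>Basis. (cmod (fourier (partial_deriv b (\<phi> i)) \<xi>))\<^sup>2)" for \<xi>
  proof -
    define F where "F = (\<Sum>i\<in>I. (cmod (fourier (\<phi> i) \<xi>))\<^sup>2)"
    have F: "0 \<le> F" "F \<le> C" using C by (auto simp: F_def sum_nonneg)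
    have "(norm \<xi>)\<^sup>2 * F = (\<Sum>i\<in>I. \<Sum>b\<in>Basis. (cmod (fourier (partial_deriv b (\<phi> i)) \<xi>))\<^sup>2)"
      unfolding F_def sum_distrib_left norm_square_Basis[of \<xi>]
      by (simp add: sum_distrib_right fourier_partial_deriv[OF \<phi>] norm_mult power_mult_distrib)
    moreover have "(s - (norm \<xi>)\<^sup>2) * F \<le> max 0 (s - (norm \<xi>)\<^sup>2) * F"
      using F(1) by (intro mult_right_mono) auto
    moreover have "\<dots> \<le> max 0 (s - (norm \<xi>)\<^sup>2) * C"
      using F(2) by (intro mult_left_mono) auto
    ultimately show ?thesis
      by (simp add: F_def[symmetric] sum_distrib_left[symmetric] algebra_simps)
  qed
  have "ennreal (K * (s * (\<Sum>i\<in>I. LINT x|lborel. (cmod (\<phi> i x))\<^sup>2)))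
      = (\<Sum>i\<in>I. ennreal s * ennreal (K * (LINT x|lborel. (cmod (\<phi> i x))\<^sup>2)))"
    using \<open>s \<ge> 0\<close> K by (simp add: sum_distrib_left ennreal_mult[symmetric] sum_nonneg mult_ac flip: sum_ennreal)
  also have "\<dots> = (\<Sum>i\<in>I. \<integral>\<^sup>+\<xi>. ennreal s * ennreal ((cmod (fourier (\<phi> i) \<xi>))\<^sup>2) \<partial>lborel)"
    by (intro sum.cong refl)
       (simp add: plancherel_test_function[OF \<phi>, folded K_def] nn_integral_cmult)
  also have "\<dots> = (\<integral>\<^sup>+\<xi>. (\<Sum>i\<in>I. ennreal s * ennreal ((cmod (fourier (\<phi> i) \<xi>))\<^sup>2)) \<partial>lborel)"
    by (rule nn_integral_sum[symmetric]) measurable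
  also have "\<dots> \<le> (\<integral>\<^sup>+\<xi>. ennreal C * ennreal (max 0 (s - (norm \<xi>)\<^sup>2))
      + (\<Sum>i\<in>I. \<Sum>b\<in>Basis. ennreal ((cmod (fourier (partial_deriv b (\<phi> i)) \<xi>))\<^sup>2)) \<partial>lborel)"
  proof (intro nn_integral_mono)
    fix \<xi> :: 'a
    show "(\<Sum>i\<in>I. ennreal s * ennreal ((cmod (fourier (\<phi> i) \<xi>))\<^sup>2)) \<le>
      ennreal C * ennreal (max 0 (s - (norm \<xi>)\<^sup>2))
      + (\<Sum>i\<in>I. \<Sum>b\<in>Basis. ennreal ((cmod (fourier (partial_deriv b (\<phi> i)) \<xi>))\<^sup>2))"
      using ennreal_leI[OF pointwise[of \<xi>]] \<open>s \<ge> 0\<close> C0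
      by (simp add: ennreal_mult[symmetric] sum_ennreal sum_nonneg ennreal_plus[symmetric] del: ennreal_plus)
  qed
  also have "\<dots> = ennreal C * (\<integral>\<^sup>+\<xi>. ennreal (max 0 (s - (norm (\<xi>::'a))\<^sup>2)) \<partial>lborel)
      + (\<Sum>i\<in>I. \<Sum>b\<in>Basis. \<integral>\<^sup>+\<xi>. ennreal ((cmod (fourier (partial_deriv b (\<phi> i)) \<xi>))\<^sup>2) \<partial>lborel)"
    by (subst nn_integral_add) (simp_all add: nn_integral_cmult nn_integral_sum del: sum_ennreal)
  also have "\<dots> = ennreal C * ennreal V
      + (\<Sum>i\<in>I. \<Sum>b\<in>Basis. ennreal (K * (LINT x|lborel. (cmod (partial_deriv b (\<phi> i) x))\<^sup>2)))"
    using \<open>s \<ge> 0\<close>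
    by (simp add: nn_integral_paraboloid V_def K_def plancherel_test_function[OF test_function_partial_deriv[OF \<phi>]])
  also have "\<dots> = ennreal (C * V + K * (\<Sum>i\<in>I. \<Sum>b\<in>Basis. LINT x|lborel. (cmod (partial_deriv b (\<phi> i) x))\<^sup>2))"
    using C0 V K by (simp add: ennreal_mult[symmetric] sum_ennreal sum_nonneg ennreal_plus[symmetric] sum_distrib_left del: ennreal_plus)
  finally have le: "ennreal (K * (s * (\<Sum>i\<in>I. LINT x|lborel. (cmod (\<phi> i x))\<^sup>2))) \<le>
      ennreal (C * V + K * (\<Sum>i\<in>I. \<Sum>b\<in>Basis. LINT x|lborel. (cmod (partial_deriv b (\<phi> i) x))\<^sup>2))" .
  have "0 \<le> C * V + K * (\<Sum>i\<in>I. \<Sum>b\<in>Basis. LINT x|lborel. (cmod (partial_deriv b (\<phi> i) x))\<^sup>2)"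
    using C0 V K by (intro add_nonneg_nonneg mult_nonneg_nonneg sum_nonneg) auto
  from le[unfolded ennreal_le_iff[OF this]] show ?thesis
    unfolding K_def V_def .
qed

section \<open>The Hermitian form of the square integrable functions\<close>

lemma L2_measurable: "u \<in> L2 \<Omega> \<Longrightarrow> u \<in> borel_measurable (lebesgue_on \<Omega>)"
  by (simp add: L2_def)

lemma L2_integrable_square: "u \<in> L2 \<Omega> \<Longrightarrow> integrable (lebesgue_on \<Omega>) (\<lambda>x. (cmod (u x))\<^sup>2)"
  by (simp add: L2_def)

lemma L2_cnj: "u \<in> L2 \<Omega> \<Longrightarrow> (\<lambda>x. cnj (u x)) \<in> L2 \<Omega>"
  by (simp add: L2_def borel_measurable_cnj)

lemma L2_scale: "u \<in> L2 \<Omega> \<Longrightarrow> (\<lambda>x. c * u x) \<in> L2 \<Omega>"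
  by (auto simp: L2_def norm_mult power_mult_distrib)

lemma L2_add:
  assumes u: "u \<in> L2 \<Omega>" and v: "v \<in> L2 \<Omega>"
  shows "(\<lambda>x. u x + v x) \<in> L2 \<Omega>"
proof -
  have [measurable]: "u \<in> borel_measurable (lebesgue_on \<Omega>)" "v \<in> borel_measurable (lebesgue_on \<Omega>)"
    using u v by (auto intro: L2_measurable)
  have le: "(cmod (u x + v x))\<^sup>2 \<le> 2 * (cmod (u x))\<^sup>2 + 2 * (cmod (v x))\<^sup>2" for x
  proof -
    have "(cmod (u x + v x))\<^sup>2 \<le> (cmod (u x) + cmod (v x))\<^sup>2"
      by (intro power_mono norm_triangle_ineq) auto
    also have "\<dots> \<le> 2 * (cmod (u x))\<^sup>2 + 2 * (cmod (v x))\<^sup>2"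
      using sum_squares_bound[of "cmod (u x)" "cmod (v x)"] by (simp add: power2_sum)
    finally show ?thesis .
  qed
  have "integrable (lebesgue_on \<Omega>) (\<lambda>x. (cmod (u x + v x))\<^sup>2)"
  proof (rule Bochner_Integration.integrable_bound)
    show "integrable (lebesgue_on \<Omega>) (\<lambda>x. 2 * (cmod (u x))\<^sup>2 + 2 * (cmod (v x))\<^sup>2)"
      using u v by (intro Bochner_Integration.integrable_add integrable_mult_right L2_integrable_square)
    show "AE x in lebesgue_on \<Omega>. norm ((cmod (u x + v x))\<^sup>2) \<le> norm (2 * (cmod (u x))\<^sup>2 + 2 * (cmod (v x))\<^sup>2)"
      using le by (intro AE_I2) auto
  qed measurable
  then show ?thesis by (simp add: L2_def)
qed

lemma L2_diff: "u \<in> L2 \<Omega> \<Longrightarrow> v \<in> L2 \<Omega> \<Longrightarrow> (\<lambda>x. u x - v x) \<in> L2 \<Omega>"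
  using L2_add[OF _ L2_scale[of v \<Omega> "-1"], of u] by simp

lemma L2_sum: "(\<And>i. i \<in> I \<Longrightarrow> u i \<in> L2 \<Omega>) \<Longrightarrow> (\<lambda>x. \<Sum>i\<in>I. u i x) \<in> L2 \<Omega>"
proof (induction I rule: infinite_finite_induct)
  case (insert i I)
  then show ?case using L2_add[of "u i" \<Omega> "\<lambda>x. \<Sum>i\<in>I. u i x"] by simp
qed (simp_all add: L2_def)

lemma L2_integrable_mult:
  assumes u: "u \<in> L2 \<Omega>" and v: "v \<in> L2 \<Omega>"
  shows "integrable (lebesgue_on \<Omega>) (\<lambda>x. u x * v x)"
proof (rule Bochner_Integration.integrable_bound)
  show "integrable (lebesgue_on \<Omega>) (\<lambda>x. (cmod (u x))\<^sup>2 + (cmod (v x))\<^sup>2)"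
    using u v by (intro Bochner_Integration.integrable_add L2_integrable_square)
  have "cmod (u x) * cmod (v x) \<le> (cmod (u x))\<^sup>2 + (cmod (v x))\<^sup>2" for x
  proof -
    have "2 * (cmod (u x) * cmod (v x)) \<le> (cmod (u x))\<^sup>2 + (cmod (v x))\<^sup>2"
      using sum_squares_bound[of "cmod (u x)" "cmod (v x)"] by simp
    moreover have "0 \<le> cmod (u x) * cmod (v x)" by simp
    ultimately show ?thesis by linarith
  qed
  then show "AE x in lebesgue_on \<Omega>. norm (u x * v x) \<le> norm ((cmod (u x))\<^sup>2 + (cmod (v x))\<^sup>2)"
    by (intro AE_I2) (simp add: norm_mult)
qed (use u v in \<open>simp add: borel_measurable_times L2_measurable\<close>)

lemma L2_inner_integrable:
  "u \<in> L2 \<Omega> \<Longrightarrow> v \<in> L2 \<Omega> \<Longrightarrow> integrable (lebesgue_on \<Omega>) (\<lambda>x. u x * cnj (v x))"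
  by (rule L2_integrable_mult[OF _ L2_cnj])

lemma L2_inner_commute: "L2_inner \<Omega> u v = cnj (L2_inner \<Omega> v u)"
  by (simp add: L2_inner_def mult.commute flip: Bochner_Integration.integral_cnj)

lemma L2_inner_scale_left: "L2_inner \<Omega> (\<lambda>x. c * u x) v = c * L2_inner \<Omega> u v"
  by (simp add: L2_inner_def mult.assoc)

lemma L2_inner_add_left:
  "u \<in> L2 \<Omega> \<Longrightarrow> v \<in> L2 \<Omega> \<Longrightarrow> w \<in> L2 \<Omega> \<Longrightarrow>
    L2_inner \<Omega> (\<lambda>x. u x + v x) w = L2_inner \<Omega> u w + L2_inner \<Omega> v w"
  by (simp add: L2_inner_def distrib_right L2_inner_integrable)

lemma L2_inner_diff_left:
  "u \<in> L2 \<Omega> \<Longrightarrow> v \<in> L2 \<Omega> \<Longrightarrow> w \<in> L2 \<Omega> \<Longrightarrow>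
    L2_inner \<Omega> (\<lambda>x. u x - v x) w = L2_inner \<Omega> u w - L2_inner \<Omega> v w"
  by (simp add: L2_inner_def left_diff_distrib L2_inner_integrable)

lemma L2_inner_sum_left:
  "(\<And>i. i \<in> I \<Longrightarrow> u i \<in> L2 \<Omega>) \<Longrightarrow> w \<in> L2 \<Omega> \<Longrightarrow>
    L2_inner \<Omega> (\<lambda>x. \<Sum>i\<in>I. c i * u i x) w = (\<Sum>i\<in>I. c i * L2_inner \<Omega> (u i) w)"
  by (simp add: L2_inner_def sum_distrib_right mult.assoc L2_inner_integrable)

lemma L2_inner_diff_right:
  "u \<in> L2 \<Omega> \<Longrightarrow> v \<in> L2 \<Omega> \<Longrightarrow> w \<in> L2 \<Omega> \<Longrightarrow>
    L2_inner \<Omega> w (\<lambda>x. u x - v x) = L2_inner \<Omega> w u - L2_inner \<Omega> w v"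
  unfolding L2_inner_commute[of \<Omega> w] by (simp add: L2_inner_diff_left)

lemma L2_inner_add_right:
  "u \<in> L2 \<Omega> \<Longrightarrow> v \<in> L2 \<Omega> \<Longrightarrow> w \<in> L2 \<Omega> \<Longrightarrow>
    L2_inner \<Omega> w (\<lambda>x. u x + v x) = L2_inner \<Omega> w u + L2_inner \<Omega> w v"
  unfolding L2_inner_commute[of \<Omega> w] by (simp add: L2_inner_add_left)

lemma L2_inner_scale_right: "L2_inner \<Omega> u (\<lambda>x. c * v x) = cnj c * L2_inner \<Omega> u v"
  unfolding L2_inner_commute[of \<Omega> u] by (simp add: L2_inner_scale_left)

lemma L2_norm_nonneg: "0 \<le> L2_norm \<Omega> u"
  by (simp add: L2_norm_def)

lemma L2_norm_square: "(L2_norm \<Omega> u)\<^sup>2 = (LINT x|lebesgue_on \<Omega>. (cmod (u x))\<^sup>2)"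
  by (simp add: L2_norm_def)

lemma L2_inner_self: "L2_inner \<Omega> u u = complex_of_real ((L2_norm \<Omega> u)\<^sup>2)"
  unfolding L2_norm_square L2_inner_def complex_norm_square[symmetric] integral_complex_of_real ..

lemma L2_norm_scale: "L2_norm \<Omega> (\<lambda>x. c * u x) = cmod c * L2_norm \<Omega> u"
  by (simp add: L2_norm_def norm_mult power_mult_distrib real_sqrt_mult)

lemma L2_norm_eq_0_AE:
  "u \<in> L2 \<Omega> \<Longrightarrow> L2_norm \<Omega> u = 0 \<Longrightarrow> AE x in lebesgue_on \<Omega>. u x = 0"
  using integral_nonneg_eq_0_iff_AE[OF L2_integrable_square, of u \<Omega>]
  by (simp add: L2_norm_def)

definition orthonormal_on :: "'a::euclidean_space set \<Rightarrow> 'i set \<Rightarrow> ('i \<Rightarrow> 'a \<Rightarrow> complex) \<Rightarrow> bool" where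
  "orthonormal_on \<Omega> I v \<longleftrightarrow> (\<forall>i\<in>I. v i \<in> L2 \<Omega>) \<and>
     (\<forall>i\<in>I. \<forall>j\<in>I. L2_inner \<Omega> (v i) (v j) = (if i = j then 1 else 0))"

text \<open>
  For an orthonormal family this is the component of \<open>w\<close> orthogonal to the span of \<open>v\<close>. It serves both
  Bessel's inequality and the Gram-Schmidt step.
\<close>

definition residual :: "'a::euclidean_space set \<Rightarrow> 'i set \<Rightarrow> ('i \<Rightarrow> 'a \<Rightarrow> complex) \<Rightarrow> ('a \<Rightarrow> complex) \<Rightarrow> 'a \<Rightarrow> complex" where
  "residual \<Omega> I v w x = w x - (\<Sum>i\<in>I. L2_inner \<Omega> w (v i) * v i x)"

lemma residual_L2:
  assumes "orthonormal_on \<Omega> I v" "w \<in> L2 \<Omega>"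
  shows "residual \<Omega> I v w \<in> L2 \<Omega>"
  unfolding residual_def[abs_def] using assms
  by (auto simp: orthonormal_on_def intro!: L2_diff L2_sum L2_scale)

lemma residual_inner:
  assumes "orthonormal_on \<Omega> I v" "w \<in> L2 \<Omega>" "z \<in> L2 \<Omega>"
  shows "L2_inner \<Omega> (residual \<Omega> I v w) z
    = L2_inner \<Omega> w z - (\<Sum>i\<in>I. L2_inner \<Omega> w (v i) * L2_inner \<Omega> (v i) z)"
  unfolding residual_def[abs_def] using assms
  by (subst L2_inner_diff_left) (auto simp: orthonormal_on_def L2_inner_sum_left intro!: L2_sum L2_scale)

lemma residual_orthogonal:
  assumes "finite I" "orthonormal_on \<Omega> I v" "w \<in> L2 \<Omega>" "j \<in> I"
  shows "L2_inner \<Omega> (residual \<Omega> I v w) (v j) = 0"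
proof -
  have "(\<Sum>i\<in>I. L2_inner \<Omega> w (v i) * L2_inner \<Omega> (v i) (v j)) = (\<Sum>i\<in>I. if i = j then L2_inner \<Omega> w (v j) else 0)"
    using assms(2,4) by (intro sum.cong) (auto simp: orthonormal_on_def)
  with assms show ?thesis
    by (subst residual_inner) (auto simp: orthonormal_on_def)
qed

text \<open>
  The difference of the two sides is the squared norm of the residual.
\<close>

lemma bessel_inequality:
  assumes "finite I" and on: "orthonormal_on \<Omega> I v" and w: "w \<in> L2 \<Omega>"
  shows "(\<Sum>i\<in>I. (cmod (L2_inner \<Omega> w (v i)))\<^sup>2) \<le> (L2_norm \<Omega> w)\<^sup>2"
proof -
  let ?r = "residual \<Omega> I v w"
  have r: "?r \<in> L2 \<Omega>" using on w by (rule residual_L2)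
  have "L2_inner \<Omega> ?r ?r = cnj (L2_inner \<Omega> ?r w)"
  proof -
    have "L2_inner \<Omega> ?r ?r = L2_inner \<Omega> w ?r - (\<Sum>i\<in>I. L2_inner \<Omega> w (v i) * L2_inner \<Omega> (v i) ?r)"
      using on w r by (rule residual_inner)
    also have "(\<Sum>i\<in>I. L2_inner \<Omega> w (v i) * L2_inner \<Omega> (v i) ?r) = 0"
      by (intro sum.neutral ballI, subst (2) L2_inner_commute)
         (simp add: residual_orthogonal[OF assms])
    finally show ?thesis by (simp add: L2_inner_commute[of \<Omega> w])
  qed
  also have "L2_inner \<Omega> ?r w = complex_of_real ((L2_norm \<Omega> w)\<^sup>2 - (\<Sum>i\<in>I. (cmod (L2_inner \<Omega> w (v i)))\<^sup>2))"
  proof -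
    have "L2_inner \<Omega> w (v i) * L2_inner \<Omega> (v i) w = complex_of_real ((cmod (L2_inner \<Omega> w (v i)))\<^sup>2)" for i
      unfolding complex_norm_square by (subst (2) L2_inner_commute) simp
    then show ?thesis
      by (simp add: residual_inner[OF on w w] L2_inner_self)
  qed
  finally have "complex_of_real ((L2_norm \<Omega> ?r)\<^sup>2)
      = complex_of_real ((L2_norm \<Omega> w)\<^sup>2 - (\<Sum>i\<in>I. (cmod (L2_inner \<Omega> w (v i)))\<^sup>2))"
    by (simp add: L2_inner_self)
  then have "(L2_norm \<Omega> ?r)\<^sup>2 = (L2_norm \<Omega> w)\<^sup>2 - (\<Sum>i\<in>I. (cmod (L2_inner \<Omega> w (v i)))\<^sup>2)"
    by (simp only: of_real_eq_iff)
  then show ?thesis by (metis diff_ge_0_iff_ge zero_le_power2)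
qed

text \<open>
  Bessel's inequality for the one-element family consisting of \<open>v\<close> normalised, when \<open>v\<close> is not a null function.
\<close>

lemma L2_cauchy_schwarz:
  assumes u: "u \<in> L2 \<Omega>" and v: "v \<in> L2 \<Omega>"
  shows "cmod (L2_inner \<Omega> u v) \<le> L2_norm \<Omega> u * L2_norm \<Omega> v"
proof (cases "L2_norm \<Omega> v = 0")
  case True
  have "L2_inner \<Omega> u v = 0"
    unfolding L2_inner_def
    using L2_norm_eq_0_AE[OF v True] by (intro integral_eq_zero_AE) auto
  then show ?thesis by (simp add: L2_norm_nonneg)
next
  case False
  let ?e = "\<lambda>x. complex_of_real (inverse (L2_norm \<Omega> v)) * v x"
  have "orthonormal_on \<Omega> {()} (\<lambda>_. ?e)"
    using v False
    by (simp add: orthonormal_on_def L2_scale L2_inner_self L2_norm_scale norm_inverse abs_of_nonneg[OF L2_norm_nonneg])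
  from bessel_inequality[OF _ this u]
  have "(cmod (L2_inner \<Omega> u ?e))\<^sup>2 \<le> (L2_norm \<Omega> u)\<^sup>2" by simp
  then have "cmod (L2_inner \<Omega> u ?e) \<le> L2_norm \<Omega> u"
    using L2_norm_nonneg by (rule power2_le_imp_le)
  then show ?thesis
    using False L2_norm_nonneg[of \<Omega> v]
    unfolding L2_inner_scale_right norm_mult complex_cnj_complex_of_real norm_of_real
    by (simp add: field_simps)
qed

lemma L2_norm_triangle:
  assumes u: "u \<in> L2 \<Omega>" and v: "v \<in> L2 \<Omega>"
  shows "L2_norm \<Omega> (\<lambda>x. u x + v x) \<le> L2_norm \<Omega> u + L2_norm \<Omega> v"
proof (rule power2_le_imp_le)
  have "complex_of_real ((L2_norm \<Omega> (\<lambda>x. u x + v x))\<^sup>2)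
      = complex_of_real ((L2_norm \<Omega> u)\<^sup>2) + complex_of_real ((L2_norm \<Omega> v)\<^sup>2)
        + (L2_inner \<Omega> u v + L2_inner \<Omega> v u)"
    unfolding L2_inner_self[symmetric] using u v
    by (simp add: L2_inner_add_left L2_inner_add_right L2_add)
  also have "L2_inner \<Omega> u v + L2_inner \<Omega> v u = complex_of_real (2 * Re (L2_inner \<Omega> u v))"
    by (subst (2) L2_inner_commute) (simp add: complex_add_cnj)
  finally have "(L2_norm \<Omega> (\<lambda>x. u x + v x))\<^sup>2
      = (L2_norm \<Omega> u)\<^sup>2 + (L2_norm \<Omega> v)\<^sup>2 + 2 * Re (L2_inner \<Omega> u v)"
    by (simp only: of_real_add[symmetric] of_real_eq_iff)
  also have "Re (L2_inner \<Omega> u v) \<le> L2_norm \<Omega> u * L2_norm \<Omega> v"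
    using complex_Re_le_cmod L2_cauchy_schwarz[OF u v] by (rule order_trans)
  finally show "(L2_norm \<Omega> (\<lambda>x. u x + v x))\<^sup>2 \<le> (L2_norm \<Omega> u + L2_norm \<Omega> v)\<^sup>2"
    by (simp add: power2_sum)
qed (simp add: L2_norm_nonneg)

lemma L2_norm_diff_triangle:
  assumes u: "u \<in> L2 \<Omega>" and v: "v \<in> L2 \<Omega>"
  shows "\<bar>L2_norm \<Omega> u - L2_norm \<Omega> v\<bar> \<le> L2_norm \<Omega> (\<lambda>x. u x - v x)"
proof -
  have "L2_norm \<Omega> u \<le> L2_norm \<Omega> (\<lambda>x. u x - v x) + L2_norm \<Omega> v"
    using L2_norm_triangle[OF L2_diff[OF u v] v] by simp
  moreover have "L2_norm \<Omega> v \<le> L2_norm \<Omega> (\<lambda>x. v x - u x) + L2_norm \<Omega> u"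
    using L2_norm_triangle[OF L2_diff[OF v u] u] by simp
  moreover have "L2_norm \<Omega> (\<lambda>x. v x - u x) = L2_norm \<Omega> (\<lambda>x. u x - v x)"
    by (simp add: L2_norm_def norm_minus_commute)
  ultimately show ?thesis by linarith
qed

lemma L2_norm_tendsto:
  assumes "\<And>n. \<phi> n \<in> L2 \<Omega>" "u \<in> L2 \<Omega>" "(\<lambda>n. L2_norm \<Omega> (\<lambda>x. \<phi> n x - u x)) \<longlonglongrightarrow> 0"
  shows "(\<lambda>n. L2_norm \<Omega> (\<phi> n)) \<longlonglongrightarrow> L2_norm \<Omega> u"
proof -
  have "(\<lambda>n. L2_norm \<Omega> (\<phi> n) - L2_norm \<Omega> u) \<longlonglongrightarrow> 0"
    by (rule Lim_null_comparison[OF _ assms(3)])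
       (use L2_norm_diff_triangle[OF assms(1,2)] in simp)
  then show ?thesis by (simp add: LIM_zero_iff)
qed

lemma L2_inner_tendsto:
  assumes "\<And>n. \<phi> n \<in> L2 \<Omega>" "u \<in> L2 \<Omega>" "(\<lambda>n. L2_norm \<Omega> (\<lambda>x. \<phi> n x - u x)) \<longlonglongrightarrow> 0" "w \<in> L2 \<Omega>"
  shows "(\<lambda>n. L2_inner \<Omega> w (\<phi> n)) \<longlonglongrightarrow> L2_inner \<Omega> w u"
proof -
  have "(\<lambda>n. L2_inner \<Omega> w (\<phi> n) - L2_inner \<Omega> w u) \<longlonglongrightarrow> 0"
  proof (rule Lim_null_comparison)
    show "(\<lambda>n. L2_norm \<Omega> w * L2_norm \<Omega> (\<lambda>x. \<phi> n x - u x)) \<longlonglongrightarrow> 0"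
      using tendsto_mult_right_zero[OF assms(3)] .
    have "norm (L2_inner \<Omega> w (\<phi> n) - L2_inner \<Omega> w u) \<le> L2_norm \<Omega> w * L2_norm \<Omega> (\<lambda>x. \<phi> n x - u x)" for n
      using L2_cauchy_schwarz[OF assms(4) L2_diff[OF assms(1)[of n] assms(2)]]
      by (simp add: L2_inner_diff_right assms)
    then show "\<forall>\<^sub>F n in sequentially. norm (L2_inner \<Omega> w (\<phi> n) - L2_inner \<Omega> w u)
        \<le> L2_norm \<Omega> w * L2_norm \<Omega> (\<lambda>x. \<phi> n x - u x)" by simp
  qed
  then show ?thesis by (simp add: LIM_zero_iff)
qed

text \<open>
  Independence is only meant up to null sets, so the induction carries along the expansion of
  each new vector in terms of \<open>u\<close>: it is what shows that the next residual has positive norm.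
\<close>

lemma gram_schmidt:
  assumes V: "V \<subseteq> L2 \<Omega>" and lin: "\<And>c u v. u \<in> V \<Longrightarrow> v \<in> V \<Longrightarrow> (\<lambda>x. c * u x + v x) \<in> V"
    and "\<And>i. i < k \<Longrightarrow> u i \<in> V" and "L2_independent \<Omega> k u"
  obtains v where "\<And>i. i < k \<Longrightarrow> v i \<in> V" "orthonormal_on \<Omega> {..<k} v"
proof -
  have lin_sum: "finite I \<Longrightarrow> (\<And>i. i \<in> I \<Longrightarrow> v i \<in> V) \<Longrightarrow> w \<in> V \<Longrightarrow> (\<lambda>x. (\<Sum>i\<in>I. c i * v i x) + w x) \<in> V"
    for I :: "nat set" and c v w
  proof (induction I rule: finite_induct)
    case (insert i I)
    then show ?case
      using lin[of "v i" "\<lambda>x. (\<Sum>i\<in>I. c i * v i x) + w x" "c i"] by (simp add: add.assoc)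
  qed simp
  have "\<exists>v a. (\<forall>i<k. v i \<in> V) \<and> orthonormal_on \<Omega> {..<k} v \<and> (\<forall>i<k. \<forall>x. v i x = (\<Sum>j<k. a i j * u j x))"
    using assms(3,4)
  proof (induction k)
    case 0
    show ?case by (simp add: orthonormal_on_def)
  next
    case (Suc k)
    have "L2_independent \<Omega> k u"
      unfolding L2_independent_def
    proof (intro allI impI)
      fix c i
      assume c: "AE x in lebesgue_on \<Omega>. (\<Sum>i<k. c i * u i x) = 0" and i: "i < k"
      have "AE x in lebesgue_on \<Omega>. (\<Sum>i<Suc k. (c(k := 0)) i * u i x) = 0"
        using c by simp
      then have "(c(k := 0)) i = 0"
        using Suc.prems(2) i unfolding L2_independent_def by (metis less_SucI)
      with i show "c i = 0" by simp
    qed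
    with Suc obtain v a where v: "\<And>i. i < k \<Longrightarrow> v i \<in> V" "orthonormal_on \<Omega> {..<k} v"
      and a: "\<And>i x. i < k \<Longrightarrow> v i x = (\<Sum>j<k. a i j * u j x)"
      by (metis less_SucI)
    have uk: "u k \<in> V" "u k \<in> L2 \<Omega>" using Suc.prems(1)[of k] V by auto
    define w where "w = residual \<Omega> {..<k} v (u k)"
    \<comment> \<open>the coefficients of \<open>w\<close> in terms of \<open>u\<close>; the one of \<open>u k\<close> is \<open>1\<close>, which forces \<open>w\<close> to be nonzero\<close>
    define d where "d j = (if j = k then 1 else - (\<Sum>i<k. L2_inner \<Omega> (u k) (v i) * a i j))" for j
    have w_eq: "w x = (\<Sum>j<Suc k. d j * u j x)" for x
    proof -
      have "(\<Sum>i<k. L2_inner \<Omega> (u k) (v i) * v i x)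
          = (\<Sum>i<k. \<Sum>j<k. L2_inner \<Omega> (u k) (v i) * a i j * u j x)"
        by (simp add: a sum_distrib_left mult.assoc)
      also have "\<dots> = (\<Sum>j<k. \<Sum>i<k. L2_inner \<Omega> (u k) (v i) * a i j * u j x)"
        by (rule sum.swap)
      also have "\<dots> = - (\<Sum>j<k. d j * u j x)"
        by (simp add: d_def sum_distrib_right flip: sum_negf)
      finally show ?thesis by (simp add: w_def residual_def d_def)
    qed
    have wV: "w \<in> V"
      using lin_sum[of "{..<k}" v "u k" "\<lambda>i. - L2_inner \<Omega> (u k) (v i)"] v(1) uk(1)
      by (simp add: w_def residual_def[abs_def] sum_negf)
    then have wL: "w \<in> L2 \<Omega>" using V by blast
    define m where "m = L2_norm \<Omega> w"
    have "m \<noteq> 0"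
    proof
      assume "m = 0"
      then have "AE x in lebesgue_on \<Omega>. (\<Sum>j<Suc k. d j * u j x) = 0"
        using L2_norm_eq_0_AE[OF wL] unfolding m_def w_eq by blast
      then have "d k = 0" using Suc.prems(2) unfolding L2_independent_def by blast
      then show False by (simp add: d_def)
    qed
    define e where "e x = complex_of_real (inverse m) * w x" for x
    \<comment> \<open>\<open>e\<close> is a multiple of \<open>w\<close>, written as \<open>(1 / m - 1) * w + w\<close> to fit the closure property of \<open>V\<close>\<close>
    have eV: "e \<in> V"
      using lin[OF wV wV, of "complex_of_real (inverse m) - 1"]
      by (simp add: e_def[abs_def] left_diff_distrib)
    have ee: "L2_inner \<Omega> e e = 1"
      unfolding L2_inner_self e_def[abs_def] L2_norm_scale m_def[symmetric]
      using \<open>m \<noteq> 0\<close> by (simp add: norm_inverse m_def L2_norm_nonneg)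
    have ev: "L2_inner \<Omega> e (v i) = 0" "L2_inner \<Omega> (v i) e = 0" if "i < k" for i
    proof -
      show "L2_inner \<Omega> e (v i) = 0"
        using residual_orthogonal[OF _ v(2) uk(2)] that
        by (simp add: e_def[abs_def] L2_inner_scale_left w_def)
      then show "L2_inner \<Omega> (v i) e = 0" by (subst L2_inner_commute) simp
    qed
    have "orthonormal_on \<Omega> {..<Suc k} (v(k := e))"
      using v(2) eV V ee ev by (auto simp: orthonormal_on_def less_Suc_eq)
    moreover have "(v(k := e)) i x = (\<Sum>j<Suc k.
        (if i = k then complex_of_real (inverse m) * d j else if j = k then 0 else a i j) * u j x)" if "i < Suc k" for i x
    proof (cases "i = k")
      case True
      then show ?thesis
        unfolding fun_upd_def by (simp only: if_True True e_def w_eq sum_distrib_left mult.assoc)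
    next
      case False
      then show ?thesis using that a[of i x] by simp
    qed
    moreover have "(v(k := e)) i \<in> V" if "i < Suc k" for i
      using that eV v(1) by (cases "i = k") auto
    ultimately show ?case
      by (intro exI[of _ "v(k := e)"] exI[of _ "\<lambda>i j. if i = k then complex_of_real (inverse m) * d j else if j = k then 0 else a i j"]) blast
  qed
  then show ?thesis using that by blast
qed

text \<open>
  Bridge between the complete measure on \<open>\<Omega>\<close>, in which the eigenvalue problem is posed, and the
  Borel measure on the whole space, in which the transform is computed.
\<close>

lemma lebesgue_on_lborel:
  fixes f :: "'a::euclidean_space \<Rightarrow> 'b::{banach, second_countable_topology}"
  assumes \<Omega>: "\<Omega> \<in> sets lebesgue" and f: "f \<in> borel_measurable borel" and 0: "\<And>x. x \<notin> \<Omega> \<Longrightarrow> f x = 0"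
  shows "integrable (lebesgue_on \<Omega>) f \<longleftrightarrow> integrable lborel f"
    and "(LINT x|lebesgue_on \<Omega>. f x) = (LINT x|lborel. f x)"
proof -
  have eq: "(\<lambda>x. indicator \<Omega> x *\<^sub>R f x) = f"
    using 0 by (auto simp: indicator_def fun_eq_iff)
  show "integrable (lebesgue_on \<Omega>) f \<longleftrightarrow> integrable lborel f"
    using \<Omega> f by (subst integrable_restrict_space) (auto simp: eq integrable_completion)
  show "(LINT x|lebesgue_on \<Omega>. f x) = (LINT x|lborel. f x)"
    using \<Omega> f by (subst integral_restrict_space) (auto simp: eq integral_completion)
qed

lemma test_function_L2:
  assumes \<Omega>: "\<Omega> \<in> sets lebesgue" and \<phi>: "\<phi> \<in> test_functions \<Omega>"
  shows "\<phi> \<in> L2 \<Omega>"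
proof -
  have m: "\<phi> \<in> borel_measurable borel" using \<phi> by (rule test_function_measurable)
  obtain B where B: "\<And>x. cmod (\<phi> x) \<le> B" by (rule test_function_bounded[OF \<phi>]) blast
  have "integrable lborel (\<lambda>x. (cmod (\<phi> x))\<^sup>2)"
  proof (rule Bochner_Integration.integrable_bound)
    show "integrable lborel (\<lambda>x. B * cmod (\<phi> x))"
      using test_function_integrable[OF \<phi>] by auto
    show "AE x in lborel. norm ((cmod (\<phi> x))\<^sup>2) \<le> norm (B * cmod (\<phi> x))"
      using B by (intro AE_I2) (auto simp: power2_eq_square abs_mult intro!: mult_right_mono order_trans[OF B])
  qed (use m in measurable)
  then have "integrable (lebesgue_on \<Omega>) (\<lambda>x. (cmod (\<phi> x))\<^sup>2)"
    using m by (subst lebesgue_on_lborel(1)[OF \<Omega>]) (auto simp: test_function_eq_0[OF \<phi>])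
  moreover have "\<phi> \<in> borel_measurable (lebesgue_on \<Omega>)"
    using m by (intro measurable_restrict_space1 measurable_completion) simp
  ultimately show ?thesis by (simp add: L2_def)
qed

lemma test_function_L2_norm:
  assumes \<Omega>: "\<Omega> \<in> sets lebesgue" and \<phi>: "\<phi> \<in> test_functions \<Omega>"
  shows "(L2_norm \<Omega> \<phi>)\<^sup>2 = (LINT x|lborel. (cmod (\<phi> x))\<^sup>2)"
  unfolding L2_norm_square using test_function_measurable[OF \<phi>]
  by (intro lebesgue_on_lborel(2)[OF \<Omega>]) (auto simp: test_function_eq_0[OF \<phi>])

definition plane_wave :: "'a::euclidean_space \<Rightarrow> 'a \<Rightarrow> complex" where
  "plane_wave \<xi> x = cis (\<xi> \<bullet> x)"

lemma plane_wave_L2: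
  assumes "\<Omega> \<in> lmeasurable"
  shows "plane_wave \<xi> \<in> L2 \<Omega>" and "(L2_norm \<Omega> (plane_wave \<xi>))\<^sup>2 = measure lebesgue \<Omega>"
proof -
  have "plane_wave \<xi> \<in> borel_measurable borel"
    unfolding plane_wave_def[abs_def] by measurable
  then have "plane_wave \<xi> \<in> borel_measurable (lebesgue_on \<Omega>)"
    by (intro measurable_restrict_space1 measurable_completion) simp
  moreover have "integrable (lebesgue_on \<Omega>) (\<lambda>x. 1::real)"
    using assms by (subst integrable_restrict_space) (auto simp: fmeasurable_def)
  ultimately show "plane_wave \<xi> \<in> L2 \<Omega>"
    by (simp add: L2_def plane_wave_def)
  have "(L2_norm \<Omega> (plane_wave \<xi>))\<^sup>2 = (LINT x|lebesgue_on \<Omega>. 1)"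
    by (simp only: L2_norm_square plane_wave_def norm_cis power_one)
  also have "\<dots> = measure lebesgue \<Omega>"
    using assms by (subst integral_restrict_space) auto
  finally show "(L2_norm \<Omega> (plane_wave \<xi>))\<^sup>2 = measure lebesgue \<Omega>" .
qed

lemma fourier_eq_L2_inner:
  assumes \<Omega>: "\<Omega> \<in> sets lebesgue" and \<phi>: "\<phi> \<in> test_functions \<Omega>"
  shows "fourier \<phi> \<xi> = L2_inner \<Omega> \<phi> (plane_wave \<xi>)"
proof -
  have [measurable]: "\<phi> \<in> borel_measurable borel" using \<phi> by (rule test_function_measurable)
  show ?thesis
    unfolding fourier_def L2_inner_def plane_wave_def cis_cnj
    by (rule lebesgue_on_lborel(2)[OF \<Omega>, symmetric]) (measurable, simp add: test_function_eq_0[OF \<phi>])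
qed

section \<open>Eigenspaces of the Dirichlet Laplacian\<close>

lemma weak_gradient_linear:
  assumes u: "has_weak_gradient \<Omega> u g" and v: "has_weak_gradient \<Omega> v h" and \<Omega>: "\<Omega> \<in> sets lebesgue"
  shows "has_weak_gradient \<Omega> (\<lambda>x. c * u x + v x) (\<lambda>b x. c * g b x + h b x)"
  unfolding has_weak_gradient_def
proof (intro conjI ballI)
  have uL: "u \<in> L2 \<Omega>" "v \<in> L2 \<Omega>" using u v by (auto simp: has_weak_gradient_def)
  then show "(\<lambda>x. c * u x + v x) \<in> L2 \<Omega>" by (intro L2_add L2_scale)
  fix b :: 'a assume b: "b \<in> Basis"
  have gL: "g b \<in> L2 \<Omega>" "h b \<in> L2 \<Omega>" using u v b by (auto simp: has_weak_gradient_def)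
  then show "(\<lambda>x. c * g b x + h b x) \<in> L2 \<Omega>" by (intro L2_add L2_scale)
  fix \<phi> assume \<phi>: "\<phi> \<in> test_functions \<Omega>"
  have \<phi>L: "\<phi> \<in> L2 \<Omega>" "partial_deriv b \<phi> \<in> L2 \<Omega>"
    using test_function_L2[OF \<Omega>] \<phi> test_function_partial_deriv[OF \<phi> b] by auto
  have "(LINT x|lebesgue_on \<Omega>. u x * partial_deriv b \<phi> x) = - (LINT x|lebesgue_on \<Omega>. g b x * \<phi> x)"
    "(LINT x|lebesgue_on \<Omega>. v x * partial_deriv b \<phi> x) = - (LINT x|lebesgue_on \<Omega>. h b x * \<phi> x)"
    using u v b \<phi> by (auto simp: has_weak_gradient_def)
  then show "(LINT x|lebesgue_on \<Omega>. (c * u x + v x) * partial_deriv b \<phi> x)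
      = - (LINT x|lebesgue_on \<Omega>. (c * g b x + h b x) * \<phi> x)"
    using uL gL \<phi>L by (simp add: distrib_right mult.assoc L2_integrable_mult)
qed

lemma L2_norm_linear_tendsto:
  assumes "\<And>n. \<phi> n \<in> L2 \<Omega>" "\<And>n. \<psi> n \<in> L2 \<Omega>" "u \<in> L2 \<Omega>" "v \<in> L2 \<Omega>"
    and "(\<lambda>n. L2_norm \<Omega> (\<lambda>x. \<phi> n x - u x)) \<longlonglongrightarrow> 0" "(\<lambda>n. L2_norm \<Omega> (\<lambda>x. \<psi> n x - v x)) \<longlonglongrightarrow> 0"
  shows "(\<lambda>n. L2_norm \<Omega> (\<lambda>x. (c * \<phi> n x + \<psi> n x) - (c * u x + v x))) \<longlonglongrightarrow> 0"
proof (rule Lim_null_comparison)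
  show "(\<lambda>n. cmod c * L2_norm \<Omega> (\<lambda>x. \<phi> n x - u x) + L2_norm \<Omega> (\<lambda>x. \<psi> n x - v x)) \<longlonglongrightarrow> 0"
    by (intro tendsto_add_zero tendsto_mult_right_zero assms)
  have "L2_norm \<Omega> (\<lambda>x. (c * \<phi> n x + \<psi> n x) - (c * u x + v x))
      \<le> cmod c * L2_norm \<Omega> (\<lambda>x. \<phi> n x - u x) + L2_norm \<Omega> (\<lambda>x. \<psi> n x - v x)" for n
  proof -
    have "(\<lambda>x. (c * \<phi> n x + \<psi> n x) - (c * u x + v x)) = (\<lambda>x. c * (\<phi> n x - u x) + (\<psi> n x - v x))"
      by (simp add: algebra_simps)
    then show ?thesis
      using L2_norm_triangle[OF L2_scale[OF L2_diff[OF assms(1)[of n] assms(3)], of c] L2_diff[OF assms(2)[of n] assms(4)]]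
      by (simp only: L2_norm_scale)
  qed
  then show "\<forall>\<^sub>F n in sequentially. norm (L2_norm \<Omega> (\<lambda>x. (c * \<phi> n x + \<psi> n x) - (c * u x + v x)))
      \<le> cmod c * L2_norm \<Omega> (\<lambda>x. \<phi> n x - u x) + L2_norm \<Omega> (\<lambda>x. \<psi> n x - v x)"
    by (simp add: L2_norm_nonneg)
qed

lemma H10_linear:
  assumes u: "u \<in> H10 \<Omega>" and v: "v \<in> H10 \<Omega>" and \<Omega>: "\<Omega> \<in> sets lebesgue"
  shows "(\<lambda>x. c * u x + v x) \<in> H10 \<Omega>"
proof -
  obtain g \<phi> where g: "has_weak_gradient \<Omega> u g" and \<phi>: "\<And>n. \<phi> n \<in> test_functions \<Omega>"
    "(\<lambda>n. L2_norm \<Omega> (\<lambda>x. \<phi> n x - u x)) \<longlonglongrightarrow> 0"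
    "\<And>b. b \<in> Basis \<Longrightarrow> (\<lambda>n. L2_norm \<Omega> (\<lambda>x. partial_deriv b (\<phi> n) x - g b x)) \<longlonglongrightarrow> 0"
    using u unfolding H10_def by blast
  obtain h \<psi> where h: "has_weak_gradient \<Omega> v h" and \<psi>: "\<And>n. \<psi> n \<in> test_functions \<Omega>"
    "(\<lambda>n. L2_norm \<Omega> (\<lambda>x. \<psi> n x - v x)) \<longlonglongrightarrow> 0"
    "\<And>b. b \<in> Basis \<Longrightarrow> (\<lambda>n. L2_norm \<Omega> (\<lambda>x. partial_deriv b (\<psi> n) x - h b x)) \<longlonglongrightarrow> 0"
    using v unfolding H10_def by blast
  have L: "u \<in> L2 \<Omega>" "v \<in> L2 \<Omega>" "\<And>b. b \<in> Basis \<Longrightarrow> g b \<in> L2 \<Omega>" "\<And>b. b \<in> Basis \<Longrightarrow> h b \<in> L2 \<Omega>"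
    using g h by (auto simp: has_weak_gradient_def)
  have pd: "partial_deriv b (\<lambda>x. c * \<phi> n x + \<psi> n x) x = c * partial_deriv b (\<phi> n) x + partial_deriv b (\<psi> n) x" for b n x
    by (intro partial_deriv_linear test_function_differentiable[OF \<phi>(1)] test_function_differentiable[OF \<psi>(1)])
  show ?thesis
    unfolding H10_def mem_Collect_eq
  proof (intro exI conjI allI ballI)
    show "has_weak_gradient \<Omega> (\<lambda>x. c * u x + v x) (\<lambda>b x. c * g b x + h b x)"
      using g h \<Omega> by (rule weak_gradient_linear)
    show "(\<lambda>x. c * \<phi> n x + \<psi> n x) \<in> test_functions \<Omega>" for n
      by (intro test_function_linear \<phi> \<psi>)
    show "(\<lambda>n. L2_norm \<Omega> (\<lambda>x. c * \<phi> n x + \<psi> n x - (c * u x + v x))) \<longlonglongrightarrow> 0"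
      by (intro L2_norm_linear_tendsto test_function_L2 \<Omega> \<phi> \<psi> L)
    show "(\<lambda>n. L2_norm \<Omega> (\<lambda>x. partial_deriv b (\<lambda>x. c * \<phi> n x + \<psi> n x) x - (c * g b x + h b x))) \<longlonglongrightarrow> 0"
      if "b \<in> Basis" for b
      unfolding pd
      by (intro L2_norm_linear_tendsto test_function_L2 \<Omega> test_function_partial_deriv \<phi> \<psi> L that)
  qed
qed

text \<open>
  The multiple \<open>\<mu> * u\<close> is pulled out of the inner product, and its square integrability follows from
  that of \<open>u\<close>.
\<close>

lemma eigenspace_iff:
  "u \<in> eigenspace \<Omega> \<mu> \<longleftrightarrow> u \<in> H10 \<Omega> \<and> (\<exists>g. has_weak_gradient \<Omega> u g \<and>
     (\<forall>v\<in>H10 \<Omega>. \<forall>h. has_weak_gradient \<Omega> v h \<longrightarrow>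
        (\<Sum>b\<in>Basis. L2_inner \<Omega> (g b) (h b)) = of_real \<mu> * L2_inner \<Omega> u v))"
  by (auto simp: eigenspace_def dirichlet_laplacian_def L2_inner_scale_left
      has_weak_gradient_def intro: L2_scale)

lemma eigenspace_subset_L2: "eigenspace \<Omega> \<mu> \<subseteq> L2 \<Omega>"
  by (auto simp: eigenspace_iff has_weak_gradient_def)

lemma eigenspace_linear:
  assumes u: "u \<in> eigenspace \<Omega> \<mu>" and v: "v \<in> eigenspace \<Omega> \<mu>" and \<Omega>: "\<Omega> \<in> sets lebesgue"
  shows "(\<lambda>x. c * u x + v x) \<in> eigenspace \<Omega> \<mu>"
proof -
  obtain g where g: "has_weak_gradient \<Omega> u g" "\<And>w h. w \<in> H10 \<Omega> \<Longrightarrow> has_weak_gradient \<Omega> w h \<Longrightarrow>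
      (\<Sum>b\<in>Basis. L2_inner \<Omega> (g b) (h b)) = of_real \<mu> * L2_inner \<Omega> u w"
    using u unfolding eigenspace_iff by blast
  obtain g' where g': "has_weak_gradient \<Omega> v g'" "\<And>w h. w \<in> H10 \<Omega> \<Longrightarrow> has_weak_gradient \<Omega> w h \<Longrightarrow>
      (\<Sum>b\<in>Basis. L2_inner \<Omega> (g' b) (h b)) = of_real \<mu> * L2_inner \<Omega> v w"
    using v unfolding eigenspace_iff by blast
  have "(\<Sum>b\<in>Basis. L2_inner \<Omega> (\<lambda>x. c * g b x + g' b x) (h b)) = of_real \<mu> * L2_inner \<Omega> (\<lambda>x. c * u x + v x) w"
    if w: "w \<in> H10 \<Omega>" "has_weak_gradient \<Omega> w h" for w h
  proof -
    have "(\<Sum>b\<in>Basis. L2_inner \<Omega> (\<lambda>x. c * g b x + g' b x) (h b))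
        = (\<Sum>b\<in>Basis. c * L2_inner \<Omega> (g b) (h b) + L2_inner \<Omega> (g' b) (h b))"
      using g(1) g'(1) w(2)
      by (intro sum.cong refl) (simp add: has_weak_gradient_def L2_inner_add_left L2_inner_scale_left L2_scale)
    also have "\<dots> = c * (of_real \<mu> * L2_inner \<Omega> u w) + of_real \<mu> * L2_inner \<Omega> v w"
      by (simp add: sum.distrib g(2)[OF w] g'(2)[OF w] flip: sum_distrib_left)
    also have "\<dots> = of_real \<mu> * L2_inner \<Omega> (\<lambda>x. c * u x + v x) w"
      using g(1) g'(1) w(2)
      by (simp add: has_weak_gradient_def L2_inner_add_left L2_inner_scale_left L2_scale algebra_simps)
    finally show ?thesis .
  qed
  moreover have "(\<lambda>x. c * u x + v x) \<in> H10 \<Omega>"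
    using u v \<Omega> by (intro H10_linear) (auto simp: eigenspace_iff)
  ultimately show ?thesis
    unfolding eigenspace_iff using weak_gradient_linear[OF g(1) g'(1) \<Omega>, of c] by blast
qed

text \<open>
  By the Hermitian symmetry of the gradient form, its value at \<open>u, v\<close> is both \<open>\<mu>\<close> and \<open>\<mu>'\<close> times the inner
  product of \<open>u\<close> and \<open>v\<close>.
\<close>

lemma eigenspaces_orthogonal:
  assumes u: "u \<in> eigenspace \<Omega> \<mu>" and v: "v \<in> eigenspace \<Omega> \<mu>'" and ne: "\<mu> \<noteq> \<mu>'"
  shows "L2_inner \<Omega> u v = 0"
proof -
  obtain g where g: "has_weak_gradient \<Omega> u g" "\<And>w h. w \<in> H10 \<Omega> \<Longrightarrow> has_weak_gradient \<Omega> w h \<Longrightarrow>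
      (\<Sum>b\<in>Basis. L2_inner \<Omega> (g b) (h b)) = of_real \<mu> * L2_inner \<Omega> u w"
    using u unfolding eigenspace_iff by blast
  obtain g' where g': "has_weak_gradient \<Omega> v g'" "\<And>w h. w \<in> H10 \<Omega> \<Longrightarrow> has_weak_gradient \<Omega> w h \<Longrightarrow>
      (\<Sum>b\<in>Basis. L2_inner \<Omega> (g' b) (h b)) = of_real \<mu>' * L2_inner \<Omega> v w"
    using v unfolding eigenspace_iff by blast
  have H: "u \<in> H10 \<Omega>" "v \<in> H10 \<Omega>" using u v by (auto simp: eigenspace_iff)
  have "of_real \<mu> * L2_inner \<Omega> u v = (\<Sum>b\<in>Basis. L2_inner \<Omega> (g b) (g' b))"
    by (rule g(2)[OF H(2) g'(1), symmetric])
  also have "\<dots> = cnj (\<Sum>b\<in>Basis. L2_inner \<Omega> (g' b) (g b))"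
    unfolding cnj_sum by (intro sum.cong refl L2_inner_commute)
  also have "\<dots> = of_real \<mu>' * L2_inner \<Omega> u v"
    by (simp add: g'(2)[OF H(1) g(1)] L2_inner_commute[of \<Omega> u v])
  finally show ?thesis using ne by simp
qed

text \<open>
  A weak substitute for uniqueness of weak gradients: against test functions, both gradients
  are given by integration by parts.
\<close>

lemma weak_gradient_test_inner_unique:
  assumes "has_weak_gradient \<Omega> u g" "has_weak_gradient \<Omega> u h" "b \<in> Basis" "\<psi> \<in> test_functions \<Omega>"
  shows "L2_inner \<Omega> (g b) \<psi> = L2_inner \<Omega> (h b) \<psi>"
proof -
  have "- (LINT x|lebesgue_on \<Omega>. g b x * cnj (\<psi> x)) = - (LINT x|lebesgue_on \<Omega>. h b x * cnj (\<psi> x))"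
    using assms test_function_cnj[OF assms(4)] unfolding has_weak_gradient_def by metis
  then show ?thesis by (simp add: L2_inner_def)
qed

text \<open>
  The definition of the form domain and the eigenvalue equation each provide a weak gradient, \<open>h\<close> and \<open>g\<close>.
  Only \<open>h\<close> is known to be a limit of gradients of test functions, and only \<open>g\<close> is known to satisfy the equation.
  As \<open>g\<close> and \<open>h\<close> agree against test functions, and \<open>h\<close> is a limit of such, the inner products of \<open>g\<close> and
  of \<open>h\<close> with \<open>h\<close> are equal; hence the energy of \<open>h\<close> is \<open>\<mu> * (L2_norm \<Omega> u)\<^sup>2\<close>.
\<close>

lemma eigenfunction_approximation:
  assumes u: "u \<in> eigenspace \<Omega> \<mu>" and \<Omega>: "\<Omega> \<in> sets lebesgue"
  obtains \<phi> where "\<And>n. \<phi> n \<in> test_functions \<Omega>"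
    "(\<lambda>n. L2_norm \<Omega> (\<lambda>x. \<phi> n x - u x)) \<longlonglongrightarrow> 0"
    "(\<lambda>n. \<Sum>b\<in>Basis. (L2_norm \<Omega> (partial_deriv b (\<phi> n)))\<^sup>2) \<longlonglongrightarrow> \<mu> * (L2_norm \<Omega> u)\<^sup>2"
proof -
  obtain g where g: "has_weak_gradient \<Omega> u g" "\<And>w h. w \<in> H10 \<Omega> \<Longrightarrow> has_weak_gradient \<Omega> w h \<Longrightarrow>
      (\<Sum>b\<in>Basis. L2_inner \<Omega> (g b) (h b)) = of_real \<mu> * L2_inner \<Omega> u w"
    using u unfolding eigenspace_iff by blast
  have uH: "u \<in> H10 \<Omega>" using u by (simp add: eigenspace_iff)
  then obtain h \<phi> where h: "has_weak_gradient \<Omega> u h" and \<phi>: "\<And>n. \<phi> n \<in> test_functions \<Omega>"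
    "(\<lambda>n. L2_norm \<Omega> (\<lambda>x. \<phi> n x - u x)) \<longlonglongrightarrow> 0"
    "\<And>b. b \<in> Basis \<Longrightarrow> (\<lambda>n. L2_norm \<Omega> (\<lambda>x. partial_deriv b (\<phi> n) x - h b x)) \<longlonglongrightarrow> 0"
    unfolding H10_def by blast
  have L: "u \<in> L2 \<Omega>" "\<And>b. b \<in> Basis \<Longrightarrow> g b \<in> L2 \<Omega>" "\<And>b. b \<in> Basis \<Longrightarrow> h b \<in> L2 \<Omega>"
    using g(1) h by (auto simp: has_weak_gradient_def)
  have dL: "partial_deriv b (\<phi> n) \<in> L2 \<Omega>" if "b \<in> Basis" for b n
    by (intro test_function_L2 \<Omega> test_function_partial_deriv \<phi> that)
  have gh: "L2_inner \<Omega> (g b) (h b) = L2_inner \<Omega> (h b) (h b)" if b: "b \<in> Basis" for b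
  proof (rule LIMSEQ_unique)
    show "(\<lambda>n. L2_inner \<Omega> (h b) (partial_deriv b (\<phi> n))) \<longlonglongrightarrow> L2_inner \<Omega> (h b) (h b)"
      by (intro L2_inner_tendsto dL L \<phi> b)
    have "(\<lambda>n. L2_inner \<Omega> (g b) (partial_deriv b (\<phi> n))) \<longlonglongrightarrow> L2_inner \<Omega> (g b) (h b)"
      by (intro L2_inner_tendsto dL L \<phi> b)
    then show "(\<lambda>n. L2_inner \<Omega> (h b) (partial_deriv b (\<phi> n))) \<longlonglongrightarrow> L2_inner \<Omega> (g b) (h b)"
      using weak_gradient_test_inner_unique[OF g(1) h b test_function_partial_deriv[OF \<phi>(1) b]] by simp
  qed
  have "complex_of_real (\<Sum>b\<in>Basis. (L2_norm \<Omega> (h b))\<^sup>2) = (\<Sum>b\<in>Basis. L2_inner \<Omega> (g b) (h b))"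
    unfolding of_real_sum by (intro sum.cong refl) (simp only: gh L2_inner_self)
  also have "\<dots> = complex_of_real (\<mu> * (L2_norm \<Omega> u)\<^sup>2)"
    by (simp only: g(2)[OF uH h] L2_inner_self of_real_mult)
  finally have "(\<Sum>b\<in>Basis. (L2_norm \<Omega> (h b))\<^sup>2) = \<mu> * (L2_norm \<Omega> u)\<^sup>2"
    by (simp only: of_real_eq_iff)
  moreover have "(\<lambda>n. \<Sum>b\<in>Basis. (L2_norm \<Omega> (partial_deriv b (\<phi> n)))\<^sup>2) \<longlonglongrightarrow> (\<Sum>b\<in>Basis. (L2_norm \<Omega> (h b))\<^sup>2)"
    by (intro tendsto_sum tendsto_power L2_norm_tendsto dL L \<phi>)
  ultimately have "(\<lambda>n. \<Sum>b\<in>Basis. (L2_norm \<Omega> (partial_deriv b (\<phi> n)))\<^sup>2) \<longlonglongrightarrow> \<mu> * (L2_norm \<Omega> u)\<^sup>2"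
    by simp
  with \<phi>(1,2) show ?thesis by (rule that)
qed

section \<open>The Li--Yau bound\<close>

text \<open>
  If \<open>\<phi> i n\<close> is within \<open>\<epsilon> i n\<close> of \<open>v i\<close>, their transforms differ by at most \<open>\<epsilon> i n\<close> times the norm of a plane
  wave, uniformly in \<open>\<xi>\<close>. So Bessel's inequality for \<open>v\<close> bounds the sum of the squared transforms of
  the test functions by a constant \<open>C n\<close> that tends to \<open>|\<Omega>|\<close>.
\<close>

lemma li_yau_orthonormal:
  fixes v :: "'i \<Rightarrow> 'a::euclidean_space \<Rightarrow> complex"
  assumes \<Omega>: "\<Omega> \<in> lmeasurable" and I: "finite I" and on: "orthonormal_on \<Omega> I v"
    and v: "\<And>i. i \<in> I \<Longrightarrow> v i \<in> eigenspace \<Omega> (\<mu> i)" and s: "s \<ge> 0"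
  shows "(2 * pi) ^ DIM('a) * (s * real (card I))
    \<le> measure lebesgue \<Omega> * (unit_ball_vol (real DIM('a)) * s powr (real DIM('a) / 2 + 1) / (real DIM('a) / 2 + 1))
      + (2 * pi) ^ DIM('a) * (\<Sum>i\<in>I. \<mu> i)"
proof -
  have \<Omega>': "\<Omega> \<in> sets lebesgue" using \<Omega> by auto
  define m where "m = measure lebesgue \<Omega>"
  have "\<forall>i\<in>I. \<exists>\<phi>. (\<forall>n. \<phi> n \<in> test_functions \<Omega>) \<and> (\<lambda>n. L2_norm \<Omega> (\<lambda>x. \<phi> n x - v i x)) \<longlonglongrightarrow> 0 \<and>
    (\<lambda>n. \<Sum>b\<in>Basis. (L2_norm \<Omega> (partial_deriv b (\<phi> n)))\<^sup>2) \<longlonglongrightarrow> \<mu> i * (L2_norm \<Omega> (v i))\<^sup>2"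
  proof
    fix i assume "i \<in> I"
    then show "\<exists>\<phi>. (\<forall>n. \<phi> n \<in> test_functions \<Omega>) \<and> (\<lambda>n. L2_norm \<Omega> (\<lambda>x. \<phi> n x - v i x)) \<longlonglongrightarrow> 0 \<and>
      (\<lambda>n. \<Sum>b\<in>Basis. (L2_norm \<Omega> (partial_deriv b (\<phi> n)))\<^sup>2) \<longlonglongrightarrow> \<mu> i * (L2_norm \<Omega> (v i))\<^sup>2"
      by (rule eigenfunction_approximation[OF v \<Omega>']) blast
  qed
  from bchoice[OF this] obtain \<phi> where
    "\<forall>i\<in>I. (\<forall>n. \<phi> i n \<in> test_functions \<Omega>) \<and> (\<lambda>n. L2_norm \<Omega> (\<lambda>x. \<phi> i n x - v i x)) \<longlonglongrightarrow> 0 \<and>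
    (\<lambda>n. \<Sum>b\<in>Basis. (L2_norm \<Omega> (partial_deriv b (\<phi> i n)))\<^sup>2) \<longlonglongrightarrow> \<mu> i * (L2_norm \<Omega> (v i))\<^sup>2"
    by blast
  then have \<phi>: "\<And>i n. i \<in> I \<Longrightarrow> \<phi> i n \<in> test_functions \<Omega>"
    "\<And>i. i \<in> I \<Longrightarrow> (\<lambda>n. L2_norm \<Omega> (\<lambda>x. \<phi> i n x - v i x)) \<longlonglongrightarrow> 0"
    "\<And>i. i \<in> I \<Longrightarrow> (\<lambda>n. \<Sum>b\<in>Basis. (L2_norm \<Omega> (partial_deriv b (\<phi> i n)))\<^sup>2) \<longlonglongrightarrow> \<mu> i * (L2_norm \<Omega> (v i))\<^sup>2"
    by auto
  have vL: "v i \<in> L2 \<Omega>" and \<phi>L: "\<phi> i n \<in> L2 \<Omega>" if "i \<in> I" for i n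
    using on test_function_L2[OF \<Omega>' \<phi>(1)[OF that]] that by (auto simp: orthonormal_on_def)
  have v1: "L2_norm \<Omega> (v i) = 1" if "i \<in> I" for i
  proof -
    have "complex_of_real ((L2_norm \<Omega> (v i))\<^sup>2) = complex_of_real 1"
      using on that by (simp only: L2_inner_self[symmetric]) (simp add: orthonormal_on_def)
    then show ?thesis
      unfolding of_real_eq_iff using L2_norm_nonneg[of \<Omega> "v i"] by (simp add: power2_eq_1_iff)
  qed
  define \<epsilon> where "\<epsilon> i n = L2_norm \<Omega> (\<lambda>x. \<phi> i n x - v i x)" for i n
  define C where "C n = m * (1 + (\<Sum>i\<in>I. 2 * \<epsilon> i n + (\<epsilon> i n)\<^sup>2))" for n
  have bound: "(\<Sum>i\<in>I. (cmod (fourier (\<phi> i n) \<xi>))\<^sup>2) \<le> C n" for n \<xi>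
  proof -
    let ?e = "plane_wave \<xi>"
    have e: "?e \<in> L2 \<Omega>" "(L2_norm \<Omega> ?e)\<^sup>2 = m"
      using plane_wave_L2[OF \<Omega>] by (auto simp: m_def)
    have "(cmod (fourier (\<phi> i n) \<xi>))\<^sup>2 \<le> (cmod (L2_inner \<Omega> ?e (v i)))\<^sup>2 + m * (2 * \<epsilon> i n + (\<epsilon> i n)\<^sup>2)"
      if i: "i \<in> I" for i
    proof -
      have "fourier (\<phi> i n) \<xi> = L2_inner \<Omega> (v i) ?e + L2_inner \<Omega> (\<lambda>x. \<phi> i n x - v i x) ?e"
        by (simp add: fourier_eq_L2_inner[OF \<Omega>' \<phi>(1)[OF i]] L2_inner_diff_left vL \<phi>L i e)
      also have "cmod \<dots> \<le> cmod (L2_inner \<Omega> (v i) ?e) + \<epsilon> i n * L2_norm \<Omega> ?e"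
        unfolding \<epsilon>_def
        by (rule norm_triangle_le, rule add_left_mono, rule L2_cauchy_schwarz[OF L2_diff[OF \<phi>L[OF i] vL[OF i]] e(1)])
      finally have "(cmod (fourier (\<phi> i n) \<xi>))\<^sup>2 \<le> (cmod (L2_inner \<Omega> (v i) ?e) + \<epsilon> i n * L2_norm \<Omega> ?e)\<^sup>2"
        by (intro power_mono) auto
      also have "\<dots> = (cmod (L2_inner \<Omega> (v i) ?e))\<^sup>2
          + 2 * \<epsilon> i n * (cmod (L2_inner \<Omega> (v i) ?e) * L2_norm \<Omega> ?e) + m * (\<epsilon> i n)\<^sup>2"
        unfolding e(2)[symmetric] by (simp add: power2_sum power_mult_distrib)
      also have "\<dots> \<le> (cmod (L2_inner \<Omega> (v i) ?e))\<^sup>2 + 2 * \<epsilon> i n * m + m * (\<epsilon> i n)\<^sup>2"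
      proof -
        have "cmod (L2_inner \<Omega> (v i) ?e) * L2_norm \<Omega> ?e \<le> m"
          using mult_right_mono[OF L2_cauchy_schwarz[OF vL[OF i] e(1)] L2_norm_nonneg[of \<Omega> ?e]]
          by (simp add: v1[OF i] e(2)[symmetric] power2_eq_square)
        then show ?thesis
          by (intro add_mono mult_left_mono order_refl) (simp_all add: \<epsilon>_def L2_norm_nonneg)
      qed
      also have "cmod (L2_inner \<Omega> (v i) ?e) = cmod (L2_inner \<Omega> ?e (v i))"
        by (subst L2_inner_commute) simp
      finally show ?thesis by (simp add: distrib_left mult_ac)
    qed
    then have "(\<Sum>i\<in>I. (cmod (fourier (\<phi> i n) \<xi>))\<^sup>2)
        \<le> (\<Sum>i\<in>I. (cmod (L2_inner \<Omega> ?e (v i)))\<^sup>2 + m * (2 * \<epsilon> i n + (\<epsilon> i n)\<^sup>2))"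
      by (rule sum_mono)
    also have "\<dots> \<le> m + m * (\<Sum>i\<in>I. 2 * \<epsilon> i n + (\<epsilon> i n)\<^sup>2)"
      using bessel_inequality[OF I on e(1)]
      unfolding sum.distrib[of _ "\<lambda>i. m * _ i"] sum_distrib_left[symmetric] e(2) by simp
    finally show ?thesis by (simp add: C_def distrib_left)
  qed
  have "(\<lambda>n. C n) \<longlonglongrightarrow> m * (1 + (\<Sum>i\<in>I. 2 * 0 + 0\<^sup>2))"
    unfolding C_def \<epsilon>_def by (intro tendsto_intros \<phi>(2))
  then have Clim: "C \<longlonglongrightarrow> m" by simp
  define V where "V = unit_ball_vol (real DIM('a)) * s powr (real DIM('a) / 2 + 1) / (real DIM('a) / 2 + 1)"
  have le: "(2 * pi) ^ DIM('a) * (s * (\<Sum>i\<in>I. (L2_norm \<Omega> (\<phi> i n))\<^sup>2))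
      \<le> C n * V + (2 * pi) ^ DIM('a) * (\<Sum>i\<in>I. \<Sum>b\<in>Basis. (L2_norm \<Omega> (partial_deriv b (\<phi> i n)))\<^sup>2)" for n
    using berezin_li_yau_test_functions[OF I \<phi>(1) bound s, of n] unfolding V_def[symmetric]
    by (simp add: test_function_L2_norm[OF \<Omega>'] test_function_partial_deriv \<phi>(1) cong: sum.cong)
  have "(\<lambda>n. (2 * pi) ^ DIM('a) * (s * (\<Sum>i\<in>I. (L2_norm \<Omega> (\<phi> i n))\<^sup>2)))
      \<longlonglongrightarrow> (2 * pi) ^ DIM('a) * (s * (\<Sum>i\<in>I. (L2_norm \<Omega> (v i))\<^sup>2))"
    by (intro tendsto_mult tendsto_const tendsto_sum tendsto_power L2_norm_tendsto \<phi>L vL \<phi>(2))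
  moreover have "(\<lambda>n. C n * V + (2 * pi) ^ DIM('a) * (\<Sum>i\<in>I. \<Sum>b\<in>Basis. (L2_norm \<Omega> (partial_deriv b (\<phi> i n)))\<^sup>2))
      \<longlonglongrightarrow> m * V + (2 * pi) ^ DIM('a) * (\<Sum>i\<in>I. \<mu> i * (L2_norm \<Omega> (v i))\<^sup>2)"
  proof (intro tendsto_add tendsto_mult[OF tendsto_const] tendsto_mult[OF Clim tendsto_const])
    show "(\<lambda>n. \<Sum>i\<in>I. \<Sum>b\<in>Basis. (L2_norm \<Omega> (partial_deriv b (\<phi> i n)))\<^sup>2)
        \<longlonglongrightarrow> (\<Sum>i\<in>I. \<mu> i * (L2_norm \<Omega> (v i))\<^sup>2)"
      by (rule tendsto_sum) (rule \<phi>(3))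
  qed
  ultimately have "(2 * pi) ^ DIM('a) * (s * (\<Sum>i\<in>I. (L2_norm \<Omega> (v i))\<^sup>2))
      \<le> m * V + (2 * pi) ^ DIM('a) * (\<Sum>i\<in>I. \<mu> i * (L2_norm \<Omega> (v i))\<^sup>2)"
    by (rule LIMSEQ_le) (use le in blast)
  then show ?thesis by (simp add: v1 m_def V_def cong: sum.cong)
qed

text \<open>
  The preceding bound at \<open>s = \<nu> * (d + 2) / d\<close>. This \<open>s\<close> minimises \<open>s powr (d / 2 + 1) / (s - \<nu>)\<close> over \<open>s > \<nu>\<close>, which up to
  constants is the resulting bound on the cardinality.
\<close>

lemma orthonormal_eigenfunctions_card_le:
  fixes v :: "'i \<Rightarrow> 'a::euclidean_space \<Rightarrow> complex"
  assumes \<Omega>: "\<Omega> \<in> lmeasurable" and I: "finite I" and on: "orthonormal_on \<Omega> I v"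
    and v: "\<And>i. i \<in> I \<Longrightarrow> v i \<in> eigenspace \<Omega> (\<mu> i)" and \<mu>: "\<And>i. i \<in> I \<Longrightarrow> \<mu> i \<le> \<nu>" and \<nu>: "\<nu> > 0"
  shows "(2 * pi) ^ DIM('a) * real (card I)
    \<le> measure lebesgue \<Omega> * unit_ball_vol (real DIM('a)) * (\<nu> * (real DIM('a) + 2) / real DIM('a)) powr (real DIM('a) / 2)"
proof -
  define d where "d = real DIM('a)"
  have d: "d > 0" by (simp add: d_def)
  define s where "s = \<nu> * (d + 2) / d"
  have s: "s > 0" using \<nu> d by (simp add: s_def)
  define K where "K = (2 * pi) ^ DIM('a)"
  have K: "K \<ge> 0" by (simp add: K_def)
  define W where "W = measure lebesgue \<Omega> * unit_ball_vol d * s powr (d / 2)"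
  have "K * (s * real (card I)) \<le> measure lebesgue \<Omega> * (unit_ball_vol d * s powr (d / 2 + 1) / (d / 2 + 1)) + K * (\<Sum>i\<in>I. \<mu> i)"
    using li_yau_orthonormal[OF \<Omega> I on v, of s] s by (simp add: K_def d_def)
  also have "(\<Sum>i\<in>I. \<mu> i) \<le> real (card I) * \<nu>"
    using \<mu> by (intro sum_bounded_above) auto
  also have "measure lebesgue \<Omega> * (unit_ball_vol d * s powr (d / 2 + 1) / (d / 2 + 1)) = W * (\<nu> * 2 / d)"
  proof -
    have "s powr (d / 2 + 1) = s powr (d / 2) * s" using s by (simp add: powr_add)
    moreover have "s / (d / 2 + 1) = \<nu> * 2 / d"
    proof -
      have "s = (\<nu> * 2 / d) * (d / 2 + 1)" "d / 2 + 1 \<noteq> 0" using d by (auto simp: s_def field_simps)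
      then show ?thesis by (metis nonzero_divide_eq_eq)
    qed
    ultimately show ?thesis by (simp add: W_def mult.assoc flip: times_divide_eq_right)
  qed
  finally have "K * (s * real (card I)) \<le> W * (\<nu> * 2 / d) + K * (real (card I) * \<nu>)"
    using K by (simp add: mult_left_mono)
  moreover have "s = \<nu> + \<nu> * 2 / d" using d by (simp add: s_def field_simps)
  ultimately have "(K * real (card I)) * (\<nu> * 2 / d) \<le> W * (\<nu> * 2 / d)"
    by (simp add: algebra_simps)
  then have "K * real (card I) \<le> W"
    by (rule mult_right_le_imp_le) (use \<nu> d in simp)
  then show ?thesis by (simp add: K_def W_def s_def d_def)
qed


section \<open>Counting eigenvalues\<close>

text \<open>
  Orthonormal families from the eigenspaces of finitely many eigenvalues, indexed by pairs of an
  eigenvalue and a position, form a single orthonormal family of size \<open>\<Sum>\<mu>\<in>F. k \<mu>\<close>.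
\<close>

lemma eigenvalue_multiplicities_bound:
  fixes \<Omega> :: "'a::euclidean_space set"
  assumes \<Omega>: "\<Omega> \<in> lmeasurable" and \<nu>: "\<nu> > 0" and F: "finite F" "F \<subseteq> {..<\<nu>}"
    and u: "\<And>\<mu>. \<mu> \<in> F \<Longrightarrow> \<exists>u. (\<forall>i<k \<mu>. u i \<in> eigenspace \<Omega> \<mu>) \<and> L2_independent \<Omega> (k \<mu>) u"
  shows "(2 * pi) ^ DIM('a) * real (\<Sum>\<mu>\<in>F. k \<mu>)
    \<le> measure lebesgue \<Omega> * unit_ball_vol (real DIM('a)) * (\<nu> * (real DIM('a) + 2) / real DIM('a)) powr (real DIM('a) / 2)"
proof -
  have \<Omega>': "\<Omega> \<in> sets lebesgue" using \<Omega> by auto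
  have "\<forall>\<mu>\<in>F. \<exists>v. (\<forall>i<k \<mu>. v i \<in> eigenspace \<Omega> \<mu>) \<and> orthonormal_on \<Omega> {..<k \<mu>} v"
  proof
    fix \<mu> assume "\<mu> \<in> F"
    then obtain u where u: "\<forall>i<k \<mu>. u i \<in> eigenspace \<Omega> \<mu>" "L2_independent \<Omega> (k \<mu>) u"
      using u by blast
    show "\<exists>v. (\<forall>i<k \<mu>. v i \<in> eigenspace \<Omega> \<mu>) \<and> orthonormal_on \<Omega> {..<k \<mu>} v"
      by (rule gram_schmidt[OF eigenspace_subset_L2 eigenspace_linear[OF _ _ \<Omega>'] _ u(2), of \<mu>])
         (use u(1) in auto)
  qed
  from bchoice[OF this] obtain v where v: "\<And>\<mu> i. \<mu> \<in> F \<Longrightarrow> i < k \<mu> \<Longrightarrow> v \<mu> i \<in> eigenspace \<Omega> \<mu>"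
    "\<And>\<mu>. \<mu> \<in> F \<Longrightarrow> orthonormal_on \<Omega> {..<k \<mu>} (v \<mu>)"
    by blast
  define I where "I = (SIGMA \<mu>:F. {..<k \<mu>})"
  have "orthonormal_on \<Omega> I (\<lambda>(\<mu>, i). v \<mu> i)"
    unfolding orthonormal_on_def
  proof (intro conjI ballI)
    fix p assume p: "p \<in> I"
    then show "(case p of (\<mu>, i) \<Rightarrow> v \<mu> i) \<in> L2 \<Omega>"
      by (auto simp: I_def intro: subsetD[OF eigenspace_subset_L2 v(1)])
    fix q assume q: "q \<in> I"
    obtain \<mu> i \<mu>' j where pq: "p = (\<mu>, i)" "q = (\<mu>', j)" by (cases p, cases q) auto
    have "L2_inner \<Omega> (v \<mu> i) (v \<mu>' j) = (if (\<mu>, i) = (\<mu>', j) then 1 else 0)"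
    proof (cases "\<mu> = \<mu>'")
      case True
      then show ?thesis
        using v(2)[of \<mu>] p q by (auto simp: pq I_def orthonormal_on_def)
    next
      case False
      then show ?thesis
        using v(1) p q eigenspaces_orthogonal[of "v \<mu> i" \<Omega> \<mu> "v \<mu>' j" \<mu>'] by (auto simp: pq I_def)
    qed
    then show "L2_inner \<Omega> (case p of (\<mu>, i) \<Rightarrow> v \<mu> i) (case q of (\<mu>, i) \<Rightarrow> v \<mu> i) = (if p = q then 1 else 0)"
      by (simp add: pq)
  qed
  moreover have "finite I" using F by (simp add: I_def)
  ultimately have "(2 * pi) ^ DIM('a) * real (card I)
    \<le> measure lebesgue \<Omega> * unit_ball_vol (real DIM('a)) * (\<nu> * (real DIM('a) + 2) / real DIM('a)) powr (real DIM('a) / 2)"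
    using v(1) F \<nu>
    by (intro orthonormal_eigenfunctions_card_le[OF \<Omega>, where \<mu>=fst and v="\<lambda>(\<mu>, i). v \<mu> i"])
       (auto simp: I_def intro: less_imp_le)
  also have "card I = (\<Sum>\<mu>\<in>F. k \<mu>)" using F by (simp add: I_def)
  finally show ?thesis .
qed

text \<open>
  The infinite sum is the supremum of its finite partial sums. In such a sum every
  multiplicity is attained: the bound for a single eigenvalue shows that the admissible sizes of
  independent families are bounded.
\<close>

lemma eigenvalue_count_le:
  assumes bound: "\<And>F k. finite F \<Longrightarrow> F \<subseteq> {..<\<nu>} \<Longrightarrow>
      (\<And>\<mu>. \<mu> \<in> F \<Longrightarrow> \<exists>u. (\<forall>i<k \<mu>. u i \<in> eigenspace \<Omega> \<mu>) \<and> L2_independent \<Omega> (k \<mu>) u) \<Longrightarrow>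
      real (\<Sum>\<mu>\<in>F. k \<mu>) \<le> B"
  shows "eigenvalue_count \<Omega> \<nu> \<le> ennreal B"
proof -
  define D where "D \<mu> = {k. \<exists>u. (\<forall>i<k. u i \<in> eigenspace \<Omega> \<mu>) \<and> L2_independent \<Omega> k u}" for \<mu>
  have fin: "finite (D \<mu>)" if "\<mu> < \<nu>" for \<mu>
  proof (rule finite_subset)
    show "D \<mu> \<subseteq> {..nat \<lfloor>B\<rfloor>}"
    proof
      fix k assume "k \<in> D \<mu>"
      then have "real k \<le> B" using bound[of "{\<mu>}" "\<lambda>_. k"] that by (auto simp: D_def)
      then show "k \<in> {..nat \<lfloor>B\<rfloor>}" by (simp add: le_nat_floor)
    qed
  qed simp
  have "0 \<in> D \<mu>" for \<mu> by (simp add: D_def L2_independent_def)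
  then have Max_in: "Max (D \<mu>) \<in> D \<mu>" if "\<mu> < \<nu>" for \<mu>
    using fin[OF that] by (intro Max_in) auto
  have mult_le: "ennreal_of_enat (multiplicity_of \<Omega> \<mu>) \<le> of_nat (Max (D \<mu>))" if "\<mu> < \<nu>" for \<mu>
  proof -
    have "multiplicity_of \<Omega> \<mu> \<le> enat (Max (D \<mu>))"
      unfolding multiplicity_of_def D_def[symmetric]
      by (intro SUP_least) (simp add: fin that)
    then show ?thesis by (metis ennreal_of_enat_enat ennreal_of_enat_le_iff)
  qed
  show ?thesis
    unfolding eigenvalue_count_def
  proof (subst nonneg_infsum_complete, simp, intro SUP_least)
    fix F assume "F \<in> {F. finite F \<and> F \<subseteq> {..<\<nu>}}"
    then have F: "finite F" "F \<subseteq> {..<\<nu>}" by auto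
    have "(\<Sum>\<mu>\<in>F. ennreal_of_enat (multiplicity_of \<Omega> \<mu>)) \<le> (\<Sum>\<mu>\<in>F. of_nat (Max (D \<mu>)))"
      using F mult_le by (intro sum_mono) auto
    also have "\<dots> = ennreal (real (\<Sum>\<mu>\<in>F. Max (D \<mu>)))"
      by (simp add: ennreal_of_nat_eq_real_of_nat)
    also have "\<dots> \<le> ennreal B"
      using Max_in F by (intro ennreal_leI bound) (auto simp: D_def)
    finally show "(\<Sum>\<mu>\<in>F. ennreal_of_enat (multiplicity_of \<Omega> \<mu>)) \<le> ennreal B" .
  qed
qed

theorem theorem11:
  fixes \<Omega> :: "'a::euclidean_space set" and \<nu> :: real
  assumes "DIM('a) \<ge> 3"
    and "open \<Omega>" and "connected \<Omega>" and "\<Omega> \<noteq> {}"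
    and "\<Omega> \<in> lmeasurable"
    and "\<nu> > 0"
  shows "eigenvalue_count \<Omega> \<nu> \<le>
    ennreal ((2 * pi) powr (- real DIM('a)) * \<nu> powr (real DIM('a) / 2) * measure lebesgue \<Omega>
      * sphere_measure (sphere (0::'a) 1) * (1 / real DIM('a))
      * (real DIM('a) / (real DIM('a) - 2)) powr (real DIM('a) / 2))"
proof (rule eigenvalue_count_le)
  fix F :: "real set" and k
  assume F: "finite F" "F \<subseteq> {..<\<nu>}"
    and u: "\<And>\<mu>. \<mu> \<in> F \<Longrightarrow> \<exists>u. (\<forall>i<k \<mu>. u i \<in> eigenspace \<Omega> \<mu>) \<and> L2_independent \<Omega> (k \<mu>) u"
  define d where "d = real DIM('a)"
  have d: "d \<ge> 3" using assms(1) by (simp add: d_def)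
  have sphere: "sphere_measure (sphere (0::'a) 1) = d * unit_ball_vol d"
  proof -
    have "d / 2 > 0" using d by simp
    then have G: "Gamma (d / 2 + 1) = d / 2 * Gamma (d / 2)"
      by (intro Gamma_plus1) (auto dest: nonpos_Ints_nonpos)
    show ?thesis
      using d unfolding sphere_measure_sphere d_def[symmetric] unit_ball_vol_def G by simp
  qed
  have product_le: "(d + 2) * (d - 2) \<le> d * d"
    by (simp add: algebra_simps)
  have "(d + 2) / d \<le> d / (d - 2)"
    using d product_le by (simp add: divide_simps)
  then have "\<nu> * (d + 2) / d \<le> \<nu> * (d / (d - 2))"
    using \<open>\<nu> > 0\<close> by (simp add: mult_left_mono flip: times_divide_eq_right)
  then have "(\<nu> * (d + 2) / d) powr (d / 2) \<le> (\<nu> * (d / (d - 2))) powr (d / 2)"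
    using d \<open>\<nu> > 0\<close> by (intro powr_mono2) auto
  also have "\<dots> = \<nu> powr (d / 2) * (d / (d - 2)) powr (d / 2)"
    by (rule powr_mult)
  finally have powr_le: "(\<nu> * (d + 2) / d) powr (d / 2) \<le> \<nu> powr (d / 2) * (d / (d - 2)) powr (d / 2)" .
  have "(2 * pi) ^ DIM('a) * real (\<Sum>\<mu>\<in>F. k \<mu>)
      \<le> measure lebesgue \<Omega> * unit_ball_vol d * (\<nu> * (d + 2) / d) powr (d / 2)"
    using eigenvalue_multiplicities_bound[OF assms(5,6) F u] by (simp only: d_def)
  also have "\<dots> \<le> measure lebesgue \<Omega> * unit_ball_vol d * (\<nu> powr (d / 2) * (d / (d - 2)) powr (d / 2))"
    using d by (intro mult_left_mono powr_le) auto
  finally have le: "(2 * pi) powr d * real (\<Sum>\<mu>\<in>F. k \<mu>)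
      \<le> measure lebesgue \<Omega> * unit_ball_vol d * (\<nu> powr (d / 2) * (d / (d - 2)) powr (d / 2))"
    by (simp add: d_def powr_realpow)
  have "real (\<Sum>\<mu>\<in>F. k \<mu>) = (2 * pi) powr (- d) * ((2 * pi) powr d * real (\<Sum>\<mu>\<in>F. k \<mu>))"
    by (simp add: powr_minus)
  also have "\<dots> \<le> (2 * pi) powr (- d)
      * (measure lebesgue \<Omega> * unit_ball_vol d * (\<nu> powr (d / 2) * (d / (d - 2)) powr (d / 2)))"
    by (intro mult_left_mono le) simp
  also have "\<dots> = (2 * pi) powr (- d) * \<nu> powr (d / 2) * measure lebesgue \<Omega>
      * sphere_measure (sphere (0::'a) 1) * (1 / d) * (d / (d - 2)) powr (d / 2)"
    using d unfolding sphere by (simp add: mult_ac)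
  finally show "real (\<Sum>\<mu>\<in>F. k \<mu>) \<le> (2 * pi) powr (- real DIM('a)) * \<nu> powr (real DIM('a) / 2)
      * measure lebesgue \<Omega> * sphere_measure (sphere (0::'a) 1) * (1 / real DIM('a))
      * (real DIM('a) / (real DIM('a) - 2)) powr (real DIM('a) / 2)"
    unfolding d_def .
qed

end
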